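(* Let $\Omega:=(0,1)$, let $k(x,y):=\min(x,y)-xy$ be the Brownian Bridge kernel, with native space $\mathcal H_k(\Omega)=H_0^1((0,1))$, and let $f(x):=x(1-x)\in\mathcal H_k(\Omega)$. (1) For every $n\in\mathbb N$, $n\geq 1$, the set $\bar X_n:=\{i/(n+1):1\le i\le n\}$ of $n$ equally spaced points is the unique set of $L_\infty(\Omega)$-optimal interpolation points for $f$, i.e. the unique minimizer of $\|f-I_Xf\|_{L_\infty(\Omega)}$ over all $X\subset\Omega$ with $|X|=n$. Setting $\bar r_n:=f-I_{\bar X_n}f$ (with $\bar X_0:=\emptyset$), one has $$\|\bar r_{n-1}\|_{L_\infty(\Omega)}=\tfrac14n^{-2},\qquad \|\bar r_{n-1}\|_{\mathcal H_k(\Omega)}=\tfrac1{\sqrt3}n^{-1},\qquad n\in\mathbb N,\ n\ge1.$$ (2) The $f$-greedy algorithm applied to $f$ selects the points $$x_{2^{\ell-1}+i}=(2i+1)/2^\ell,\qquad \ell\in\mathbb N,\ \ell\ge1,\ i=0,\dots,2^{\ell-1}-1,$$ where the points corresponding to the same index $\ell$ may be chosen in any order. For these points, setting $X_n:=\{x_1,\dots,x_n\}$, $r_n:=f-I_{X_n}f$ and $n:=2^{\ell-1}+i$, one has for all $\ell\ge1$ and $i=0,\dots,2^{\ell-1}-1$ $$\|r_{n-1}\|_{L_\infty(\Omega)}=2^{-2\ell},\qquad \|r_{n-1}\|_{\mathcal H_k(\Omega)}=\left(\frac{2^{1-3\ell}}3\left(2^{\ell+1}-3i\right)\right)^{1/2}.$$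 (3) In particular, for all $n\in\mathbb N$, $$\frac{\sqrt3}{4\sqrt2}(n+1)^{-1}=\frac1{\sqrt2}\frac{\|\bar r_n\|_{L_\infty((0,1))}}{\|\bar r_n\|_{\mathcal H_k(\Omega)}}\le\frac{\|r_n\|_{L_\infty((0,1))}}{\|r_n\|_{\mathcal H_k(\Omega)}}\le4\,\frac{\|\bar r_n\|_{L_\infty((0,1))}}{\|\bar r_n\|_{\mathcal H_k(\Omega)}}=\sqrt3\,(n+1)^{-1}.$$
   Context: $\mathcal H_k(\Omega)$ is the Reproducing Kernel Hilbert Space of $k$ on $\Omega=(0,1)$; it equals $H_0^1((0,1))$ with inner product $\langle u,v\rangle=\int_0^1u'(x)v'(x)\,dx$. For a finite set $X\subset\Omega$ of pairwise distinct points, $I_Xf$ is the unique element of $\mathrm{span}\{k(\cdot,x):x\in X\}$ interpolating $f$ at $X$, with $I_\emptyset f=0$. The $f$-greedy algorithm sets $X_0:=\emptyset$, $X_{n+1}:=X_n\cup\{x_{n+1}\}$, with $x_{n+1}\in\Omega\setminus X_n$ chosen as any maximizer over $\Omega\setminus X_n$ of $|(f-I_{X_n}f)(x)|$. *)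

theory Defs
  imports "HOL-Analysis.Analysis" "HOL-Probability.Essential_Supremum"
begin

section \<open>Reproducing kernel Hilbert spaces\<close>

text \<open>
  A function on a domain \<open>D\<close> is represented by a total function whose values outside \<open>D\<close> are
  irrelevant: the carrier \<open>H\<close> is closed under changing functions outside \<open>D\<close>, and definiteness
  of the inner product is required up to equality on \<open>D\<close>.
\<close>

definition is_rkhs ::
  "'a set \<Rightarrow> ('a \<Rightarrow> 'a \<Rightarrow> real) \<Rightarrow> ('a \<Rightarrow> real) set
    \<Rightarrow> (('a \<Rightarrow> real) \<Rightarrow> ('a \<Rightarrow> real) \<Rightarrow> real) \<Rightarrow> bool"
where
  "is_rkhs D k H ip \<longleftrightarrow>
     (\<lambda>_. 0) \<in> H \<and>
     (\<forall>u\<in>H. \<forall>v\<in>H. (\<lambda>x. u x + v x) \<in> H) \<and>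
     (\<forall>c. \<forall>u\<in>H. (\<lambda>x. c * u x) \<in> H) \<and>
     (\<forall>u\<in>H. \<forall>v. (\<forall>x\<in>D. v x = u x) \<longrightarrow> v \<in> H) \<and>
     (\<forall>u\<in>H. \<forall>v\<in>H. ip u v = ip v u) \<and>
     (\<forall>u\<in>H. \<forall>v\<in>H. \<forall>w\<in>H. ip (\<lambda>x. u x + v x) w = ip u w + ip v w) \<and>
     (\<forall>c. \<forall>u\<in>H. \<forall>v\<in>H. ip (\<lambda>x. c * u x) v = c * ip u v) \<and>
     (\<forall>u\<in>H. 0 \<le> ip u u) \<and>
     (\<forall>u\<in>H. ip u u = 0 \<longleftrightarrow> (\<forall>x\<in>D. u x = 0)) \<and>
     \<comment> \<open>completeness\<close>
     (\<forall>s. (\<forall>n. s n \<in> H) \<and>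
          (\<forall>e>0. \<exists>N::nat. \<forall>m\<ge>N. \<forall>n\<ge>N.
             sqrt (ip (\<lambda>x. s m x - s n x) (\<lambda>x. s m x - s n x)) < e) \<longrightarrow>
          (\<exists>u\<in>H. (\<lambda>n. sqrt (ip (\<lambda>x. s n x - u x) (\<lambda>x. s n x - u x))) \<longlonglongrightarrow> 0)) \<and>
     \<comment> \<open>reproducing property\<close>
     (\<forall>x\<in>D. (\<lambda>y. k y x) \<in> H) \<and>
     (\<forall>u\<in>H. \<forall>x\<in>D. ip u (\<lambda>y. k y x) = u x)"


section \<open>Kernel interpolation and the greedy algorithm\<close>

definition kernel_span :: "('a \<Rightarrow> 'a \<Rightarrow> real) \<Rightarrow> 'a set \<Rightarrow> ('a \<Rightarrow> real) set" where
  "kernel_span k X = {\<lambda>y. \<Sum>x\<in>X. c x * k y x | c. True}"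

definition interpolant :: "('a \<Rightarrow> 'a \<Rightarrow> real) \<Rightarrow> 'a set \<Rightarrow> ('a \<Rightarrow> real) \<Rightarrow> 'a \<Rightarrow> real" where
  "interpolant k X f = (THE s. s \<in> kernel_span k X \<and> (\<forall>x\<in>X. s x = f x))"

definition residual :: "('a \<Rightarrow> 'a \<Rightarrow> real) \<Rightarrow> 'a set \<Rightarrow> ('a \<Rightarrow> real) \<Rightarrow> 'a \<Rightarrow> real" where
  "residual k X f = (\<lambda>y. f y - interpolant k X f y)"

text \<open>
  The selected points are \<open>x 1, x 2, \<dots>\<close>; the value \<open>x 0\<close> plays no role.
\<close>

definition f_greedy :: "'a set \<Rightarrow> ('a \<Rightarrow> 'a \<Rightarrow> real) \<Rightarrow> ('a \<Rightarrow> real) \<Rightarrow> (nat \<Rightarrow> 'a) \<Rightarrow> bool" where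
  "f_greedy D k f x \<longleftrightarrow>
     (\<forall>n. x (Suc n) \<in> D - x ` {1..n} \<and>
          (\<forall>y \<in> D - x ` {1..n}.
             \<bar>residual k (x ` {1..n}) f y\<bar> \<le> \<bar>residual k (x ` {1..n}) f (x (Suc n))\<bar>))"


section \<open>The Brownian bridge kernel on the unit interval\<close>

abbreviation \<Omega> :: "real set" where
  "\<Omega> \<equiv> {0<..<1}"

definition bridge_kernel :: "real \<Rightarrow> real \<Rightarrow> real" where
  "bridge_kernel x y = min x y - x * y"

definition parabola :: "real \<Rightarrow> real" where
  "parabola x = x * (1 - x)"

text \<open>
  The real-valued norm is meaningful for essentially bounded functions only, since
  \<open>real_of_ereal\<close> sends infinity to \<open>0\<close>.
\<close>

definition Linf_norm :: "(real \<Rightarrow> real) \<Rightarrow> real" where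
  "Linf_norm u = real_of_ereal (esssup (lebesgue_on \<Omega>) (\<lambda>x. ereal \<bar>u x\<bar>))"

text \<open>
  Elements of the Sobolev space \<open>H\<^sup>1(0,1)\<close> are taken as their (locally absolutely) continuous
  representatives, so point evaluation makes sense; zero trace then means that the function
  tends to \<open>0\<close> at both end points.  The weak derivative \<open>g\<close> is determined only almost everywhere,
  which the integral in the inner product does not see.
\<close>

definition has_L2_derivative :: "(real \<Rightarrow> real) \<Rightarrow> (real \<Rightarrow> real) \<Rightarrow> bool" where
  "has_L2_derivative u g \<longleftrightarrow>
     g \<in> borel_measurable (lebesgue_on \<Omega>) \<and>
     integrable (lebesgue_on \<Omega>) (\<lambda>t. (g t)\<^sup>2) \<and>
     (\<forall>a\<in>\<Omega>. \<forall>b\<in>\<Omega>. a \<le> b \<longrightarrow> u b - u a = (LINT t:{a..b}|lebesgue. g t))"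

definition H01 :: "(real \<Rightarrow> real) set" where
  "H01 = {u. (\<exists>g. has_L2_derivative u g) \<and>
             (u \<longlongrightarrow> 0) (at_right 0) \<and> (u \<longlongrightarrow> 0) (at_left 1)}"

definition weak_deriv :: "(real \<Rightarrow> real) \<Rightarrow> real \<Rightarrow> real" where
  "weak_deriv u = (SOME g. has_L2_derivative u g)"

definition H01_inner :: "(real \<Rightarrow> real) \<Rightarrow> (real \<Rightarrow> real) \<Rightarrow> real" where
  "H01_inner u v = (LINT t:\<Omega>|lebesgue. weak_deriv u t * weak_deriv v t)"

definition H01_norm :: "(real \<Rightarrow> real) \<Rightarrow> real" where
  "H01_norm u = sqrt (H01_inner u u)"

definition equi_points :: "nat \<Rightarrow> real set" where
  "equi_points n = {real i / real (n + 1) | i. 1 \<le> i \<and> i \<le> n}"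

abbreviation equi_residual :: "nat \<Rightarrow> real \<Rightarrow> real" where
  "equi_residual n \<equiv> residual bridge_kernel (equi_points n) parabola"

abbreviation point_residual :: "(nat \<Rightarrow> real) \<Rightarrow> nat \<Rightarrow> real \<Rightarrow> real" where
  "point_residual x n \<equiv> residual bridge_kernel (x ` {1..n}) parabola"

end

theory Submission
  imports Defs
begin

text \<open>
  Between neighbouring points \<open>a < b\<close> of \<open>X \<union> {0, 1}\<close> the residual of the parabola is
  \<open>(y - a) * (b - y)\<close>: the interpolant is piecewise linear with kinks only at \<open>X\<close>. Hence the uniform
  norm is a quarter of the squared longest gap, which turns part (1) into a statement about gap
  lengths, and the greedy choice is always the midpoint of a longest gap. Inserting \<open>z\<close> into the gap
  \<open>(a, b)\<close> subtracts from the residual the hat function \<open>hat a z b\<close>, a combination of the kernel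
  translates at \<open>a\<close>, \<open>z\<close>, \<open>b\<close>; by reproduction this lowers the squared energy norm by
  \<open>(b - a) * (z - a) * (b - z)\<close>, so all energy norms follow by inserting points one at a time.
\<close>

section \<open>Square-integrable functions\<close>

text \<open>The end points 0 and 1 do not belong to \<open>\<Omega>\<close>, yet the first and the
  last gap end there. This is harmless because the kernel translates at 0 and 1 vanish on [0,1]: a
  hat function resting on an end point still agrees there with a combination of translates at
  genuine points. The price is that identities between total functions are available on [0,1] only,
  so the inner product has to be shown insensitive to values outside \<open>\<Omega>\<close>. Since
  \<open>interpolant\<close> is a definite description, unisolvence must be settled before any
  formula for the residual can be used. The dyadic pattern comes from ties. When the points consist
  of a grid of mesh 1/N and some cell midpoints, uncut cells have length 1/N and cut ones leave gaps
  of length 1/(2N). The maximizers are therefore exactly the midpoints of the uncut cells, whichever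
  were taken before: every order within a level is possible, and the level ends precisely at the
  grid of mesh 1/(2N). The only energy obtained by integration is the value 1/3 for the parabola
  itself.\<close>

lemma (in finite_measure) square_integral_abs_le:
  fixes f :: "'a \<Rightarrow> real"
  assumes [measurable]: "f \<in> borel_measurable M" and f2: "integrable M (\<lambda>x. (f x)\<^sup>2)"
  shows "(\<integral>x. \<bar>f x\<bar> \<partial>M)\<^sup>2 \<le> (\<integral>x. (f x)\<^sup>2 \<partial>M) * measure M (space M)"
proof -
  have f1: "integrable M f"
    by (rule square_integrable_imp_integrable[OF assms])
  \<comment> \<open>The factor 1 is made explicit so that Cauchy-Schwarz bounds the L^1 norm by the
    L^2 norm and the total mass.\<close>
  have "ennreal ((\<integral>x. \<bar>f x\<bar> \<partial>M)\<^sup>2) = (\<integral>\<^sup>+x. ennreal \<bar>f x\<bar> * 1 \<partial>M)\<^sup>2"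
    using f1 by (simp add: nn_integral_eq_integral ennreal_power)
  also have "\<dots> \<le> (\<integral>\<^sup>+x. (ennreal \<bar>f x\<bar>)\<^sup>2 \<partial>M) * (\<integral>\<^sup>+x. 1\<^sup>2 \<partial>M)"
    by (rule Cauchy_Schwarz_nn_integral) auto
  also have "\<dots> = ennreal ((\<integral>x. (f x)\<^sup>2 \<partial>M) * measure M (space M))"
    using f2 by (simp add: ennreal_power nn_integral_eq_integral emeasure_eq_measure ennreal_mult)
  finally show ?thesis
    by (simp add: ennreal_le_iff)
qed

lemma integrable_mult_of_squares:
  fixes f g :: "'a \<Rightarrow> real"
  assumes [measurable]: "f \<in> borel_measurable M" "g \<in> borel_measurable M"
    and "integrable M (\<lambda>x. (f x)\<^sup>2)" "integrable M (\<lambda>x. (g x)\<^sup>2)"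
  shows "integrable M (\<lambda>x. f x * g x)"
proof (rule Bochner_Integration.integrable_bound)
  show "integrable M (\<lambda>x. (f x)\<^sup>2 + (g x)\<^sup>2)"
    using assms by auto
  have "\<bar>a * b\<bar> \<le> \<bar>a\<^sup>2 + b\<^sup>2\<bar>" for a b :: real
  proof -
    have "2 * (\<bar>a\<bar> * \<bar>b\<bar>) \<le> a\<^sup>2 + b\<^sup>2" "0 \<le> \<bar>a\<bar> * \<bar>b\<bar>"
      using sum_squares_bound[of "\<bar>a\<bar>" "\<bar>b\<bar>"] by (simp_all add: mult.assoc)
    then have "\<bar>a\<bar> * \<bar>b\<bar> \<le> a\<^sup>2 + b\<^sup>2" by linarith
    then show ?thesis by (simp add: abs_mult)
  qed
  then show "AE x in M. norm (f x * g x) \<le> norm ((f x)\<^sup>2 + (g x)\<^sup>2)"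
    by simp
qed auto

lemma integrable_square_lincomb:
  fixes f g :: "'a \<Rightarrow> real"
  assumes [measurable]: "f \<in> borel_measurable M" "g \<in> borel_measurable M"
    and "integrable M (\<lambda>x. (f x)\<^sup>2)" "integrable M (\<lambda>x. (g x)\<^sup>2)"
  shows "integrable M (\<lambda>x. (a * f x + b * g x)\<^sup>2)"
proof -
  have "integrable M (\<lambda>x. a\<^sup>2 * (f x)\<^sup>2 + b\<^sup>2 * (g x)\<^sup>2 + 2 * a * b * (f x * g x))"
    using assms integrable_mult_of_squares[OF assms] by auto
  then show ?thesis
    by (simp add: power2_sum power_mult_distrib mult_ac)
qed

text \<open>Integral and sum of nonnegative functions may be exchanged, so the pointwise sum has
  finite integral and is finite almost everywhere.\<close>

lemma AE_summable_of_summable_integral: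
  fixes d :: "nat \<Rightarrow> 'a \<Rightarrow> real"
  assumes int: "\<And>k. integrable M (d k)" and sum: "summable (\<lambda>k. \<integral>x. \<bar>d k x\<bar> \<partial>M)"
  shows "AE x in M. summable (\<lambda>k. \<bar>d k x\<bar>)"
proof -
  have [measurable]: "d k \<in> borel_measurable M" for k
    using int by auto
  have "(\<integral>\<^sup>+x. (\<Sum>k. ennreal \<bar>d k x\<bar>) \<partial>M) = (\<Sum>k. ennreal (\<integral>x. \<bar>d k x\<bar> \<partial>M))"
  proof -
    have "(\<integral>\<^sup>+x. ennreal \<bar>d k x\<bar> \<partial>M) = ennreal (\<integral>x. \<bar>d k x\<bar> \<partial>M)" for k
      using int by (intro nn_integral_eq_integral) auto
    then show ?thesis
      by (subst nn_integral_suminf) auto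
  qed
  also have "\<dots> < \<infinity>"
    using sum by (simp add: suminf_ennreal2 less_top[symmetric])
  finally have "AE x in M. (\<Sum>k. ennreal \<bar>d k x\<bar>) \<noteq> \<infinity>"
    by (intro nn_integral_PInf_AE) auto
  then show ?thesis
    by eventually_elim (auto intro!: summable_suminf_not_top)
qed

text \<open>Riesz--Fischer: on a finite measure space a rapidly converging subsequence is absolutely
  summable in \<open>L\<^sup>1\<close>, hence converges almost everywhere, and Fatou's lemma identifies its limit as
  the \<open>L\<^sup>2\<close> limit.\<close>

lemma (in finite_measure) L2_complete:
  fixes g :: "nat \<Rightarrow> 'a \<Rightarrow> real"
  assumes [measurable]: "\<And>n. g n \<in> borel_measurable M"
    and g2: "\<And>n. integrable M (\<lambda>x. (g n x)\<^sup>2)"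
    and cauchy: "\<And>e. e > 0 \<Longrightarrow> \<exists>N. \<forall>m\<ge>N. \<forall>n\<ge>N. (\<integral>x. (g m x - g n x)\<^sup>2 \<partial>M) < e"
  obtains G where "G \<in> borel_measurable M" "integrable M (\<lambda>x. (G x)\<^sup>2)"
    "(\<lambda>n. \<integral>x. (g n x - G x)\<^sup>2 \<partial>M) \<longlonglongrightarrow> 0"
proof -
  have diff2: "integrable M (\<lambda>x. (g m x - g n x)\<^sup>2)" for m n
    using integrable_square_lincomb[of "g m" M "g n" 1 "-1"] g2 by simp
  \<comment> \<open>Squared distances are bounded by \<open>(1/4)^k\<close> so that the square roots
    \<open>(1/2)^k\<close> are summable.\<close>
  have "\<exists>N. \<forall>m\<ge>N. \<forall>n\<ge>N. (\<integral>x. (g m x - g n x)\<^sup>2 \<partial>M) < (1/4)^k" for k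
    by (rule cauchy) simp
  then obtain N where "\<forall>k. \<forall>m\<ge>N k. \<forall>n\<ge>N k. (\<integral>x. (g m x - g n x)\<^sup>2 \<partial>M) < (1/4)^k"
    using choice[of "\<lambda>k N. \<forall>m\<ge>N. \<forall>n\<ge>N. (\<integral>x. (g m x - g n x)\<^sup>2 \<partial>M) < (1/4)^k"] by blast
  then have N: "\<And>k m n. m \<ge> N k \<Longrightarrow> n \<ge> N k \<Longrightarrow> (\<integral>x. (g m x - g n x)\<^sup>2 \<partial>M) < (1/4)^k"
    by blast
  \<comment> \<open>A partial sum dominates each of its terms, so \<open>r k\<close> lies beyond all
    thresholds up to \<open>N k\<close> although \<open>N\<close> need not be monotone.\<close>
  define r where "r k = (\<Sum>j\<le>k. N j)" for k
  have r_ge: "r k \<ge> N j" if "j \<le> k" for j k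
    unfolding r_def using that by (intro member_le_sum) auto
  define d where "d k x = g (r (Suc k)) x - g (r k) x" for k x
  have [measurable]: "d k \<in> borel_measurable M" for k
    unfolding d_def by measurable
  have d2: "integrable M (\<lambda>x. (d k x)\<^sup>2)" for k
    unfolding d_def by (rule diff2)
  have d1: "integrable M (d k)" for k
    by (rule square_integrable_imp_integrable) (use d2 in auto)
  have d_le: "(\<integral>x. \<bar>d k x\<bar> \<partial>M) \<le> sqrt (measure M (space M)) * (1/2)^k" for k
  proof -
    have "(\<integral>x. \<bar>d k x\<bar> \<partial>M)\<^sup>2 \<le> (\<integral>x. (d k x)\<^sup>2 \<partial>M) * measure M (space M)"
      by (rule square_integral_abs_le) (use d2 in auto)
    also have "\<dots> \<le> (1/4)^k * measure M (space M)"
      unfolding d_def by (intro mult_right_mono less_imp_le[OF N]) (auto intro: r_ge)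
    also have "\<dots> = (sqrt (measure M (space M)) * (1/2)^k)\<^sup>2"
      by (simp add: power_mult_distrib power_divide power2_eq_square[of "2 ^ k"] flip: power_mult_distrib)
    finally show ?thesis
      by (rule power2_le_imp_le) auto
  qed
  have sum_int: "summable (\<lambda>k. \<integral>x. \<bar>d k x\<bar> \<partial>M)"
    by (rule summable_comparison_test'[where g="\<lambda>k. sqrt (measure M (space M)) * (1/2)^k"])
      (use d_le in \<open>auto intro!: summable_mult summable_geometric\<close>)
  have AE_sum: "AE x in M. summable (\<lambda>k. \<bar>d k x\<bar>)"
    by (rule AE_summable_of_summable_integral[OF d1 sum_int])
  \<comment> \<open>On the null set where the series diverges \<open>suminf\<close> yields a default
    value; \<open>G\<close> is nevertheless measurable everywhere.\<close>
  define G where "G x = g (r 0) x + (\<Sum>k. d k x)" for x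
  have G_meas[measurable]: "G \<in> borel_measurable M"
    unfolding G_def by measurable
  have AE_lim: "AE x in M. (\<lambda>k. g (r k) x) \<longlonglongrightarrow> G x"
    using AE_sum
  proof eventually_elim
    case (elim x)
    then have "(\<lambda>k. d k x) sums (\<Sum>k. d k x)"
      by (rule summable_sums[OF summable_rabs_cancel])
    then have "(\<lambda>k. g (r 0) x + (\<Sum>j<k. d j x)) \<longlonglongrightarrow> G x"
      unfolding sums_def G_def by (intro tendsto_intros)
    moreover have "g (r 0) x + (\<Sum>j<k. d j x) = g (r k) x" for k
      unfolding d_def using sum_lessThan_telescope[of "\<lambda>j. g (r j) x" k] by simp
    ultimately show ?case by simp
  qed
  have fatou: "(\<integral>\<^sup>+x. ennreal ((g n x - G x)\<^sup>2) \<partial>M) \<le> ennreal ((1/4)^j)" if "n \<ge> N j" for n j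
  proof -
    have "(\<integral>\<^sup>+x. ennreal ((g n x - G x)\<^sup>2) \<partial>M)
        = (\<integral>\<^sup>+x. liminf (\<lambda>k. ennreal ((g n x - g (r k) x)\<^sup>2)) \<partial>M)"
    proof (rule nn_integral_cong_AE)
      show "AE x in M. ennreal ((g n x - G x)\<^sup>2) = liminf (\<lambda>k. ennreal ((g n x - g (r k) x)\<^sup>2))"
        using AE_lim
      proof eventually_elim
        case (elim x)
        have "(\<lambda>k. ennreal ((g n x - g (r k) x)\<^sup>2)) \<longlonglongrightarrow> ennreal ((g n x - G x)\<^sup>2)"
          by (intro tendsto_ennrealI tendsto_intros elim)
        from lim_imp_Liminf[OF _ this] show ?case by simp
      qed
    qed
    also have "\<dots> \<le> liminf (\<lambda>k. \<integral>\<^sup>+x. ennreal ((g n x - g (r k) x)\<^sup>2) \<partial>M)"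
      by (rule nn_integral_liminf) auto
    also have "\<dots> \<le> ennreal ((1/4)^j)"
    proof (rule Liminf_le)
      show "\<forall>\<^sub>F k in sequentially. (\<integral>\<^sup>+x. ennreal ((g n x - g (r k) x)\<^sup>2) \<partial>M) \<le> ennreal ((1/4)^j)"
      proof (rule eventually_sequentiallyI[of j])
        fix k assume "j \<le> k"
        then show "(\<integral>\<^sup>+x. ennreal ((g n x - g (r k) x)\<^sup>2) \<partial>M) \<le> ennreal ((1/4)^j)"
          using less_imp_le[OF N[OF that r_ge, of k]] diff2[of n "r k"]
          by (simp add: nn_integral_eq_integral ennreal_leI)
      qed
    qed simp
    finally show ?thesis .
  qed
  have lim2: "integrable M (\<lambda>x. (g n x - G x)\<^sup>2)" "(\<integral>x. (g n x - G x)\<^sup>2 \<partial>M) \<le> (1/4)^j"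
    if "n \<ge> N j" for n j
  proof -
    show *: "integrable M (\<lambda>x. (g n x - G x)\<^sup>2)"
      using fatou[OF that] by (intro integrableI_nonneg) (auto intro: le_less_trans)
    show "(\<integral>x. (g n x - G x)\<^sup>2 \<partial>M) \<le> (1/4)^j"
      using fatou[OF that] nn_integral_eq_integral[OF *] by (simp add: ennreal_le_iff)
  qed
  \<comment> \<open>\<open>G\<close> is written as \<open>g (N 0)\<close> minus
    \<open>g (N 0) - G\<close>, both of which are square integrable.\<close>
  have "integrable M (\<lambda>x. (1 * g (N 0) x + (-1) * (g (N 0) x - G x))\<^sup>2)"
    using lim2(1)[of 0 "N 0"] g2 by (intro integrable_square_lincomb) auto
  then have "integrable M (\<lambda>x. (G x)\<^sup>2)"
    by simp
  moreover have "(\<lambda>n. \<integral>x. (g n x - G x)\<^sup>2 \<partial>M) \<longlonglongrightarrow> 0"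
  proof (rule LIMSEQ_I)
    fix e :: real assume "e > 0"
    then obtain j where j: "(1/4::real)^j < e"
      using real_arch_pow_inv[of e "1/4"] by auto
    have "norm ((\<integral>x. (g n x - G x)\<^sup>2 \<partial>M) - 0) < e" if "n \<ge> N j" for n
      using lim2(2)[OF that] j Bochner_Integration.integral_nonneg[of M "\<lambda>x. (g n x - G x)\<^sup>2"] by simp
    then show "\<exists>no. \<forall>n\<ge>no. norm ((\<integral>x. (g n x - G x)\<^sup>2 \<partial>M) - 0) < e" by blast
  qed
  ultimately show ?thesis
    using that G_meas by blast
qed

section \<open>Weak derivatives\<close>

lemma finite_measure_unit_interval: "finite_measure (lebesgue_on \<Omega>)"
  by (rule finite_measure_lebesgue_on) simp

lemma measure_unit_interval: "measure (lebesgue_on \<Omega>) \<Omega> = 1"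
  by (simp add: measure_restrict_space)

lemma integrable_on_unit_interval:
  fixes g :: "real \<Rightarrow> real"
  assumes "integrable (lebesgue_on \<Omega>) g"
  shows "g integrable_on {0..1}" "integral\<^sup>L (lebesgue_on \<Omega>) g = integral {0..1} g"
proof -
  have "(g has_integral integral\<^sup>L (lebesgue_on \<Omega>) g) \<Omega>"
    by (rule has_integral_integral_lebesgue_on[OF assms]) simp
  then have *: "(g has_integral integral\<^sup>L (lebesgue_on \<Omega>) g) {0..1}"
    using has_integral_Icc_iff_Ioo by blast
  show "g integrable_on {0..1}" "integral\<^sup>L (lebesgue_on \<Omega>) g = integral {0..1} g"
    using * by (auto simp: integral_unique)
qed

lemma set_integral_subinterval:
  fixes g :: "real \<Rightarrow> real"
  assumes "integrable (lebesgue_on \<Omega>) g" "a \<in> \<Omega>" "b \<in> \<Omega>"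
  shows "(LINT t:{a..b}|lebesgue. g t) = integral {a..b} g"
proof -
  have "set_integrable lebesgue \<Omega> g"
    using assms(1) by (simp add: set_integrable_def integrable_restrict_space)
  then have "set_integrable lebesgue {a..b} g"
    by (rule set_integrable_subset) (use assms in auto)
  then show ?thesis
    by (rule set_lebesgue_integral_eq_integral)
qed

text \<open>Lebesgue differentiation: off a negligible set the right-hand difference quotients of
  the primitive converge to the integrand, and here all of them are zero.\<close>

lemma AE_zero_of_integral_zero:
  fixes g :: "real \<Rightarrow> real"
  assumes int: "integrable (lebesgue_on \<Omega>) g"
    and zero: "\<And>a b. a \<in> \<Omega> \<Longrightarrow> b \<in> \<Omega> \<Longrightarrow> a \<le> b \<Longrightarrow> integral {a..b} g = 0"
  shows "AE x in lebesgue_on \<Omega>. g x = 0"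
proof -
  \<comment> \<open>Extension by zero, so that the differentiation theorem on the whole line
    applies.\<close>
  define f where "f x = (if x \<in> \<Omega> then g x else 0)" for x
  have "(\<lambda>x. indicator \<Omega> x *\<^sub>R g x) = f"
    by (auto simp: f_def fun_eq_iff indicator_def)
  then have "f absolutely_integrable_on UNIV"
    using int unfolding set_integrable_def by (simp add: integrable_restrict_space)
  then have "f absolutely_integrable_on cbox a b" for a b
    by (rule set_integrable_subset) auto
  then have "f integrable_on cbox a b" for a b
    by (rule set_lebesgue_integral_eq_integral)
  then obtain S where S: "negligible S"
    "\<And>x e. \<lbrakk>x \<notin> S; 0 < e\<rbrakk> \<Longrightarrow> \<exists>d>0. \<forall>h. 0 < h \<and> h < d \<longrightarrow>
        norm (integral (cbox x (x + h *\<^sub>R One)) f /\<^sub>R h ^ DIM(real) - f x) < e"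
    using integrable_ccontinuous_explicit[of f] by metis
  have "g x = 0" if x: "x \<in> \<Omega>" "x \<notin> S" for x
  proof (rule ccontr)
    assume "g x \<noteq> 0"
    then obtain d where "d > 0" and
      d: "\<And>h. 0 < h \<Longrightarrow> h < d \<Longrightarrow> \<bar>integral {x..x + h} f / h - f x\<bar> < \<bar>g x\<bar>"
      using S(2)[OF x(2), of "\<bar>g x\<bar>"] by (auto simp: divide_inverse mult.commute)
    \<comment> \<open>Halving the minimum keeps \<open>h\<close> strictly below \<open>d\<close> and
      \<open>x + h\<close> strictly inside the interval.\<close>
    define h where "h = min d (1 - x) / 2"
    have h: "0 < h" "h < d" "x + h < 1"
      using \<open>d > 0\<close> x unfolding h_def by (auto simp: field_simps min_def)
    have "integral {x..x + h} f = integral {x..x + h} g"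
      by (rule integral_cong) (use h x in \<open>auto simp: f_def\<close>)
    also have "\<dots> = 0"
      using zero[of x "x + h"] h x by auto
    finally show False
      using d[OF h(1,2)] x by (simp add: f_def)
  qed
  moreover have "AE x in lebesgue. x \<notin> S"
    using S(1) by (simp add: negligible_iff_null_sets AE_not_in)
  ultimately show ?thesis
    by (auto simp: AE_restrict_space_iff elim: eventually_mono)
qed

lemma has_L2_derivativeD:
  assumes "has_L2_derivative u g"
  shows "g \<in> borel_measurable (lebesgue_on \<Omega>)"
    and "integrable (lebesgue_on \<Omega>) (\<lambda>t. (g t)\<^sup>2)"
    and "integrable (lebesgue_on \<Omega>) g"
    and "g integrable_on {0..1}"
    and "\<And>a b. a \<in> \<Omega> \<Longrightarrow> b \<in> \<Omega> \<Longrightarrow> a \<le> b \<Longrightarrow> u b - u a = integral {a..b} g"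
proof -
  show 1: "g \<in> borel_measurable (lebesgue_on \<Omega>)" and 2: "integrable (lebesgue_on \<Omega>) (\<lambda>t. (g t)\<^sup>2)"
    using assms unfolding has_L2_derivative_def by auto
  show 3: "integrable (lebesgue_on \<Omega>) g"
    by (rule finite_measure.square_integrable_imp_integrable[OF finite_measure_unit_interval 1 2])
  show "g integrable_on {0..1}"
    by (rule integrable_on_unit_interval(1)[OF 3])
  show "\<And>a b. a \<in> \<Omega> \<Longrightarrow> b \<in> \<Omega> \<Longrightarrow> a \<le> b \<Longrightarrow> u b - u a = integral {a..b} g"
    using assms set_integral_subinterval[OF 3] unfolding has_L2_derivative_def by auto
qed

text \<open>\<open>weak_deriv\<close> is an arbitrary choice among all derivatives; this is what
  makes integrals over it independent of the choice.\<close>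

lemma has_L2_derivative_unique:
  assumes "has_L2_derivative u g" "has_L2_derivative u h"
  shows "AE x in lebesgue_on \<Omega>. g x = h x"
proof -
  note g = has_L2_derivativeD[OF assms(1)] and h = has_L2_derivativeD[OF assms(2)]
  have "AE x in lebesgue_on \<Omega>. g x - h x = 0"
  proof (rule AE_zero_of_integral_zero)
    fix a b :: real assume ab: "a \<in> \<Omega>" "b \<in> \<Omega>" "a \<le> b"
    have "g integrable_on {a..b}" "h integrable_on {a..b}"
      using ab by (auto intro: integrable_subinterval_real[OF g(4)] integrable_subinterval_real[OF h(4)])
    then show "integral {a..b} (\<lambda>x. g x - h x) = 0"
      using g(5)[OF ab] h(5)[OF ab] by (simp add: Henstock_Kurzweil_Integration.integral_diff)
  qed (use g(3) h(3) in auto)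
  then show ?thesis by simp
qed

section \<open>\<open>H01\<close> as the space of primitives of square-integrable functions with
  mean zero\<close>

lemma integral_sub_initial:
  fixes g :: "real \<Rightarrow> real"
  assumes "g integrable_on {0..1}" "0 \<le> a" "a \<le> b" "b \<le> 1"
  shows "integral {a..b} g = integral {0..b} g - integral {0..a} g"
  using Henstock_Kurzweil_Integration.integral_combine[of 0 a b g]
    integrable_subinterval_real[OF assms(1), of 0 b] assms by auto

lemma initial_integral_tendsto:
  fixes g :: "real \<Rightarrow> real"
  assumes "g integrable_on {0..1}"
  shows "((\<lambda>x. integral {0..x} g) \<longlongrightarrow> 0) (at_right 0)"
    and "((\<lambda>x. integral {0..x} g) \<longlongrightarrow> integral {0..1} g) (at_left 1)"
proof -
  have c: "continuous_on {0..1} (\<lambda>x. integral {0..x} g)"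
    by (rule indefinite_integral_continuous_1[OF assms])
  show "((\<lambda>x. integral {0..x} g) \<longlongrightarrow> 0) (at_right 0)"
    using continuous_on_Icc_at_rightD[OF c] by simp
  show "((\<lambda>x. integral {0..x} g) \<longlongrightarrow> integral {0..1} g) (at_left 1)"
    using continuous_on_Icc_at_leftD[OF c] by simp
qed

lemma eventually_in_unit_interval:
  "\<forall>\<^sub>F x in at_right (0::real). x \<in> \<Omega>" "\<forall>\<^sub>F x in at_left (1::real). x \<in> \<Omega>"
  by (auto simp: eventually_at_right_field eventually_at_left_field intro: exI[of _ 1] exI[of _ 0])

text \<open>A primitive is determined up to a constant. The limit at 0 forces this constant to be
  zero, and the limit at 1 then forces the derivative to have mean zero.\<close>

lemma H01_eq_integral:
  assumes "u \<in> H01" "has_L2_derivative u g"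
  shows "\<And>x. x \<in> \<Omega> \<Longrightarrow> u x = integral {0..x} g" and "integral {0..1} g = 0"
proof -
  note g = has_L2_derivativeD[OF assms(2)]
  \<comment> \<open>The constant is read off at an interior point, since the value of
    \<open>u\<close> at 0 itself is unconstrained.\<close>
  define c where "c = u (1/2) - integral {0..1/2} g"
  have u: "u x = integral {0..x} g + c" if "x \<in> \<Omega>" for x
    using that g(5)[of x "1/2"] g(5)[of "1/2" x]
      integral_sub_initial[OF g(4), of x "1/2"] integral_sub_initial[OF g(4), of "1/2" x]
    by (cases "x \<le> 1/2") (auto simp: c_def)
  have "((\<lambda>x. integral {0..x} g + c) \<longlongrightarrow> 0 + c) (at_right 0)"
    by (intro tendsto_intros initial_integral_tendsto g)
  then have "(u \<longlongrightarrow> c) (at_right 0)"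
    using u by (auto elim!: Lim_transform_eventually intro: eventually_mono[OF eventually_in_unit_interval(1)])
  moreover have "(u \<longlongrightarrow> 0) (at_right 0)"
    using assms(1) by (simp add: H01_def)
  ultimately have "c = 0"
    using tendsto_unique[OF trivial_limit_at_right_real] by blast
  with u show ux: "\<And>x. x \<in> \<Omega> \<Longrightarrow> u x = integral {0..x} g"
    by simp
  have "(u \<longlongrightarrow> integral {0..1} g) (at_left 1)"
    by (rule Lim_transform_eventually[OF initial_integral_tendsto(2)[OF g(4)]])
      (use ux in \<open>auto intro: eventually_mono[OF eventually_in_unit_interval(2)]\<close>)
  moreover have "(u \<longlongrightarrow> 0) (at_left 1)"
    using assms(1) by (simp add: H01_def)
  ultimately show "integral {0..1} g = 0"
    using tendsto_unique[OF trivial_limit_at_left_real] by blast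
qed

text \<open>The converse, used as the test for membership: it asks for the values of
  \<open>u\<close> on \<open>\<Omega>\<close> only.\<close>

lemma H01_of_integral:
  assumes m: "g \<in> borel_measurable (lebesgue_on \<Omega>)"
    and i: "integrable (lebesgue_on \<Omega>) (\<lambda>t. (g t)\<^sup>2)"
    and u: "\<And>x. x \<in> \<Omega> \<Longrightarrow> u x = integral {0..x} g" and z: "integral {0..1} g = 0"
  shows "has_L2_derivative u g" "u \<in> H01"
proof -
  have g1: "integrable (lebesgue_on \<Omega>) g"
    by (rule finite_measure.square_integrable_imp_integrable[OF finite_measure_unit_interval m i])
  note g = integrable_on_unit_interval(1)[OF g1]
  have "u b - u a = (LINT t:{a..b}|lebesgue. g t)" if "a \<in> \<Omega>" "b \<in> \<Omega>" "a \<le> b" for a b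
    using integral_sub_initial[OF g, of a b] set_integral_subinterval[OF g1, of a b]
      u[of a] u[of b] that by simp
  then show "has_L2_derivative u g"
    unfolding has_L2_derivative_def using m i by simp
  moreover have "(u \<longlongrightarrow> 0) (at_right 0)"
    by (rule Lim_transform_eventually[OF initial_integral_tendsto(1)[OF g]])
      (use u in \<open>auto intro: eventually_mono[OF eventually_in_unit_interval(1)]\<close>)
  moreover have "(u \<longlongrightarrow> 0) (at_left 1)"
    by (rule Lim_transform_eventually[OF initial_integral_tendsto(2)[OF g, unfolded z]])
      (use u in \<open>auto intro: eventually_mono[OF eventually_in_unit_interval(2)]\<close>)
  ultimately show "u \<in> H01"
    by (auto simp: H01_def)
qed

section \<open>The inner product of \<open>H01\<close> and completeness\<close>

lemma H01_weak_deriv: "u \<in> H01 \<Longrightarrow> has_L2_derivative u (weak_deriv u)"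
  unfolding H01_def weak_deriv_def using someI_ex[of "has_L2_derivative u"] by blast

text \<open>Frees later computations from the chosen \<open>weak_deriv\<close>: any derivative at
  hand may be inserted, because two of them differ on a null set only.\<close>

lemma H01_inner_eq:
  assumes "has_L2_derivative u g" "has_L2_derivative v h"
  shows "H01_inner u v = (\<integral>t. g t * h t \<partial>lebesgue_on \<Omega>)"
proof -
  have wu: "has_L2_derivative u (weak_deriv u)" and wv: "has_L2_derivative v (weak_deriv v)"
    unfolding weak_deriv_def using someI[of "has_L2_derivative u" g] someI[of "has_L2_derivative v" h] assms
    by simp_all
  have "H01_inner u v = (\<integral>t. weak_deriv u t * weak_deriv v t \<partial>lebesgue_on \<Omega>)"
    unfolding H01_inner_def set_lebesgue_integral_def by (subst integral_restrict_space) auto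
  also have "\<dots> = (\<integral>t. g t * h t \<partial>lebesgue_on \<Omega>)"
  proof (rule integral_cong_AE)
    show "AE t in lebesgue_on \<Omega>. weak_deriv u t * weak_deriv v t = g t * h t"
      using has_L2_derivative_unique[OF wu assms(1)] has_L2_derivative_unique[OF wv assms(2)]
      by eventually_elim simp
  qed (use has_L2_derivativeD(1)[OF wu] has_L2_derivativeD(1)[OF wv]
        has_L2_derivativeD(1)[OF assms(1)] has_L2_derivativeD(1)[OF assms(2)] in \<open>auto\<close>)
  finally show ?thesis .
qed

lemma has_L2_derivative_lincomb:
  assumes "has_L2_derivative u g" "has_L2_derivative v h"
  shows "has_L2_derivative (\<lambda>x. a * u x + b * v x) (\<lambda>x. a * g x + b * h x)"
proof -
  note g = has_L2_derivativeD[OF assms(1)] and h = has_L2_derivativeD[OF assms(2)]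
  have 1: "integrable (lebesgue_on \<Omega>) (\<lambda>x. a * g x + b * h x)"
    using g(3) h(3) by auto
  have "(a * u d + b * v d) - (a * u c + b * v c) = integral {c..d} (\<lambda>x. a * g x + b * h x)"
    if cd: "c \<in> \<Omega>" "d \<in> \<Omega>" "c \<le> d" for c d
  proof -
    have "g integrable_on {c..d}" "h integrable_on {c..d}"
      using cd by (auto intro: integrable_subinterval_real[OF g(4)] integrable_subinterval_real[OF h(4)])
    then have "integral {c..d} (\<lambda>x. a * g x + b * h x) = a * integral {c..d} g + b * integral {c..d} h"
      by (subst Henstock_Kurzweil_Integration.integral_add) (auto intro: integrable_on_mult_right)
    then show ?thesis
      by (simp add: g(5)[OF cd, symmetric] h(5)[OF cd, symmetric] algebra_simps)
  qed
  then show ?thesis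
    unfolding has_L2_derivative_def
    using integrable_square_lincomb[OF g(1) h(1) g(2) h(2)] g(1) h(1) set_integral_subinterval[OF 1]
    by auto
qed

lemma has_L2_derivative_diff:
  assumes "has_L2_derivative u g" "has_L2_derivative v h"
  shows "has_L2_derivative (\<lambda>x. u x - v x) (\<lambda>x. g x - h x)"
  using has_L2_derivative_lincomb[OF assms, of 1 "-1"] by simp

lemma H01_lincomb:
  assumes "u \<in> H01" "v \<in> H01"
  shows "(\<lambda>x. a * u x + b * v x) \<in> H01"
proof -
  have "((\<lambda>x. a * u x + b * v x) \<longlongrightarrow> a * 0 + b * 0) (at_right 0)"
    using assms unfolding H01_def by (intro tendsto_intros) auto
  moreover have "((\<lambda>x. a * u x + b * v x) \<longlongrightarrow> a * 0 + b * 0) (at_left 1)"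
    using assms unfolding H01_def by (intro tendsto_intros) auto
  ultimately show ?thesis
    using has_L2_derivative_lincomb[OF H01_weak_deriv[OF assms(1)] H01_weak_deriv[OF assms(2)], of a b]
    unfolding H01_def by auto
qed

lemma H01_inner_lincomb:
  assumes "u \<in> H01" "v \<in> H01" "w \<in> H01"
  shows "H01_inner (\<lambda>x. a * u x + b * v x) w = a * H01_inner u w + b * H01_inner v w"
proof -
  note d = H01_weak_deriv[OF assms(1)] H01_weak_deriv[OF assms(2)] H01_weak_deriv[OF assms(3)]
  have "integrable (lebesgue_on \<Omega>) (\<lambda>t. weak_deriv u t * weak_deriv w t)"
    "integrable (lebesgue_on \<Omega>) (\<lambda>t. weak_deriv v t * weak_deriv w t)"
    using has_L2_derivativeD(1,2)[OF d(1)] has_L2_derivativeD(1,2)[OF d(2)]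
      has_L2_derivativeD(1,2)[OF d(3)] by (auto intro!: integrable_mult_of_squares)
  moreover have "H01_inner (\<lambda>x. a * u x + b * v x) w =
     (\<integral>t. a * (weak_deriv u t * weak_deriv w t) + b * (weak_deriv v t * weak_deriv w t) \<partial>lebesgue_on \<Omega>)"
    by (simp add: H01_inner_eq[OF has_L2_derivative_lincomb[OF d(1,2)] d(3)] algebra_simps)
  ultimately show ?thesis
    by (simp add: H01_inner_eq[OF d(1) d(3)] H01_inner_eq[OF d(2) d(3)])
qed

lemma H01_inner_commute: "H01_inner u v = H01_inner v u"
  unfolding H01_inner_def by (simp add: mult.commute)

lemma H01_inner_self:
  assumes "has_L2_derivative u g"
  shows "H01_inner u u = (\<integral>t. (g t)\<^sup>2 \<partial>lebesgue_on \<Omega>)"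
  by (simp add: H01_inner_eq[OF assms assms] power2_eq_square)

lemma H01_inner_self_nonneg: "u \<in> H01 \<Longrightarrow> 0 \<le> H01_inner u u"
  using H01_inner_self[OF H01_weak_deriv] by simp

text \<open>Zero energy makes the derivative vanish almost everywhere; the zero boundary value
  excludes nonzero constants.\<close>

lemma H01_inner_self_eq_0_iff:
  assumes "u \<in> H01"
  shows "H01_inner u u = 0 \<longleftrightarrow> (\<forall>x\<in>\<Omega>. u x = 0)"
proof
  note d = H01_weak_deriv[OF assms]
  note g = has_L2_derivativeD[OF d]
  assume "H01_inner u u = 0"
  then have "AE t in lebesgue_on \<Omega>. (weak_deriv u t)\<^sup>2 = 0"
    using integral_nonneg_eq_0_iff_AE[OF g(2)] by (simp add: H01_inner_self[OF d])
  then have ae: "AE t in lebesgue_on \<Omega>. weak_deriv u t = 0"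
    by simp
  show "\<forall>x\<in>\<Omega>. u x = 0"
  proof
    fix x :: real assume x: "x \<in> \<Omega>"
    have sub: "{0<..<x} \<subseteq> \<Omega>"
      using x by auto
    have "AE t in lebesgue. t \<in> \<Omega> \<longrightarrow> weak_deriv u t = 0"
      using ae by (simp add: AE_restrict_space_iff)
    then have "AE t in lebesgue. t \<in> {0<..<x} \<longrightarrow> weak_deriv u t = 0"
      by eventually_elim (use sub in auto)
    then obtain S where "{t \<in> {0<..<x}. weak_deriv u t \<noteq> 0} \<subseteq> S" "negligible S"
      by (elim AE_E) (auto simp: negligible_iff_null_sets null_sets_def)
    then have "(weak_deriv u has_integral 0) {0<..<x}"
      by (intro has_integral_spike[OF _ _ has_integral_0]) auto
    then have "integral {0..x} (weak_deriv u) = 0"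
      using has_integral_Icc_iff_Ioo integral_unique by blast
    then show "u x = 0"
      using H01_eq_integral(1)[OF assms d x] by simp
  qed
next
  assume *: "\<forall>x\<in>\<Omega>. u x = 0"
  have "has_L2_derivative u (\<lambda>t. 0)"
    by (rule H01_of_integral) (use * in auto)
  from H01_inner_self[OF this] show "H01_inner u u = 0"
    by simp
qed

text \<open>The derivatives form a Cauchy sequence in L^2. Taking the mean is continuous in L^2, so
  the limit again has mean zero and its primitive lies in \<open>H01\<close>.\<close>

lemma H01_complete:
  assumes s: "\<And>n. s n \<in> H01"
    and cauchy: "\<And>e. e > 0 \<Longrightarrow> \<exists>N::nat. \<forall>m\<ge>N. \<forall>n\<ge>N.
      sqrt (H01_inner (\<lambda>x. s m x - s n x) (\<lambda>x. s m x - s n x)) < e"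
  shows "\<exists>u\<in>H01. (\<lambda>n. sqrt (H01_inner (\<lambda>x. s n x - u x) (\<lambda>x. s n x - u x))) \<longlonglongrightarrow> 0"
proof -
  define g where "g n = weak_deriv (s n)" for n
  interpret finite_measure "lebesgue_on \<Omega>"
    by (rule finite_measure_unit_interval)
  have d: "has_L2_derivative (s n) (g n)" for n
    unfolding g_def by (rule H01_weak_deriv[OF s])
  note g = has_L2_derivativeD[OF d]
  have inner_diff: "H01_inner (\<lambda>x. s n x - u x) (\<lambda>x. s n x - u x) = (\<integral>t. (g n t - h t)\<^sup>2 \<partial>lebesgue_on \<Omega>)"
    if "has_L2_derivative u h" for n u h
    using H01_inner_self[OF has_L2_derivative_diff[OF d that]] by simp
  obtain G where G: "G \<in> borel_measurable (lebesgue_on \<Omega>)" "integrable (lebesgue_on \<Omega>) (\<lambda>x. (G x)\<^sup>2)"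
    "(\<lambda>n. \<integral>x. (g n x - G x)\<^sup>2 \<partial>lebesgue_on \<Omega>) \<longlonglongrightarrow> 0"
  proof (rule L2_complete[of g])
    fix e :: real assume "e > 0"
    then obtain N where N: "\<forall>m\<ge>N. \<forall>n\<ge>N. sqrt (H01_inner (\<lambda>x. s m x - s n x) (\<lambda>x. s m x - s n x)) < sqrt e"
      using cauchy[of "sqrt e"] by auto
    then show "\<exists>N. \<forall>m\<ge>N. \<forall>n\<ge>N. (\<integral>x. (g m x - g n x)\<^sup>2 \<partial>lebesgue_on \<Omega>) < e"
      by (auto simp: inner_diff[OF d])
  qed (use g(1,2) in auto)
  have G1: "integrable (lebesgue_on \<Omega>) G"
    by (rule square_integrable_imp_integrable[OF G(1,2)])
  \<comment> \<open>As \<open>g n\<close> has mean zero, the mean of \<open>G\<close> is up to sign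
    that of \<open>g n - G\<close>, which is controlled by the L^2 distance.\<close>
  have "(\<integral>x. G x \<partial>lebesgue_on \<Omega>)\<^sup>2 \<le> (\<integral>x. (g n x - G x)\<^sup>2 \<partial>lebesgue_on \<Omega>)" for n
  proof -
    have "(\<integral>x. g n x \<partial>lebesgue_on \<Omega>) = 0"
      using integrable_on_unit_interval(2)[OF g(3)] H01_eq_integral(2)[OF s d] by simp
    then have "\<bar>\<integral>x. G x \<partial>lebesgue_on \<Omega>\<bar> = \<bar>\<integral>x. g n x - G x \<partial>lebesgue_on \<Omega>\<bar>"
      using g(3) G1 by simp
    also have "\<dots> \<le> (\<integral>x. \<bar>g n x - G x\<bar> \<partial>lebesgue_on \<Omega>)"
      by (rule integral_abs_bound)
    finally have "(\<integral>x. G x \<partial>lebesgue_on \<Omega>)\<^sup>2 \<le> (\<integral>x. \<bar>g n x - G x\<bar> \<partial>lebesgue_on \<Omega>)\<^sup>2"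
      by (subst power2_abs[symmetric]) (intro power_mono; simp)
    also have "\<dots> \<le> (\<integral>x. (g n x - G x)\<^sup>2 \<partial>lebesgue_on \<Omega>) * measure (lebesgue_on \<Omega>) (space (lebesgue_on \<Omega>))"
      using integrable_square_lincomb[OF g(1) G(1) g(2) G(2), of 1 n "-1"] g(1)[of n] G(1)
      by (intro square_integral_abs_le) auto
    finally show ?thesis
      by (simp only: space_lebesgue_on measure_unit_interval mult_1_right)
  qed
  then have "(\<integral>x. G x \<partial>lebesgue_on \<Omega>)\<^sup>2 \<le> 0"
    by (intro LIMSEQ_le_const[OF G(3)]) auto
  then have G0: "integral {0..1} G = 0"
    using integrable_on_unit_interval(2)[OF G1] by simp
  define u where "u x = integral {0..x} G" for x
  have u: "has_L2_derivative u G" "u \<in> H01"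
    by (rule H01_of_integral[OF G(1,2) _ G0]; simp add: u_def)+
  have "(\<lambda>n. sqrt (H01_inner (\<lambda>x. s n x - u x) (\<lambda>x. s n x - u x))) \<longlonglongrightarrow> sqrt 0"
    unfolding inner_diff[OF u(1)] by (intro tendsto_real_sqrt G(3))
  then show ?thesis
    using u(2) by auto
qed

section \<open>The Brownian bridge kernel as reproducing kernel\<close>

lemma bridge_kernel_deriv:
  assumes x: "x \<in> \<Omega>"
  defines "h \<equiv> \<lambda>t. if t \<le> x then 1 - x else - x"
  shows "has_L2_derivative (\<lambda>y. bridge_kernel y x) h" "(\<lambda>y. bridge_kernel y x) \<in> H01"
proof -
  have m: "h \<in> borel_measurable (lebesgue_on \<Omega>)"
  proof -
    have "h \<in> borel_measurable borel"
      unfolding h_def by measurable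
    then show ?thesis
      by (simp add: measurable_completion measurable_restrict_space1 borel_measurable_subalgebra)
  qed
  have h_bound: "\<bar>h t\<bar> \<le> 1" for t
    using x by (auto simp: h_def)
  have i: "integrable (lebesgue_on \<Omega>) (\<lambda>t. (h t)\<^sup>2)"
    using m h_bound
    by (intro finite_measure.integrable_const_bound[OF finite_measure_unit_interval, where B=1])
      (auto simp: abs_square_le_1)
  have left: "(h has_integral (y * (1 - x))) {0..y}" if "0 \<le> y" "y \<le> x" for y
  proof (rule has_integral_eq)
    show "((\<lambda>_. 1 - x) has_integral (y * (1 - x))) {0..y}"
      using has_integral_const_real[of "1 - x" 0 y] that(1) by simp
  qed (use that in \<open>simp add: h_def\<close>)
  \<comment> \<open>At \<open>x\<close> itself \<open>h\<close> takes its left value, a single point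
    that the integral ignores.\<close>
  have right: "(h has_integral ((y - x) * (- x))) {x..y}" if "x \<le> y" for y
  proof (rule has_integral_spike_finite[of "{x}"])
    show "((\<lambda>_. - x) has_integral ((y - x) * (- x))) {x..y}"
      using has_integral_const_real[of "- x" x y] that by simp
  qed (auto simp: h_def)
  have h_int: "(h has_integral bridge_kernel y x) {0..y}" if "0 \<le> y" for y
  proof (cases "y \<le> x")
    case True
    then show ?thesis
      using left[of y] that by (simp add: bridge_kernel_def algebra_simps)
  next
    case False
    have "(h has_integral x * (1 - x) + (y - x) * (- x)) {0..y}"
      by (rule has_integral_combine[OF _ _ left right]) (use x False in auto)
    then show ?thesis
      using False by (simp add: bridge_kernel_def algebra_simps)
  qed
  show "has_L2_derivative (\<lambda>y. bridge_kernel y x) h" "(\<lambda>y. bridge_kernel y x) \<in> H01"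
    using integral_unique[OF h_int] x
    by (intro H01_of_integral[OF m i]; simp; simp add: bridge_kernel_def)+
qed

text \<open>The derivative of the kernel translate is a step function with a unit jump down at
  \<open>x\<close>. Pairing it with the derivative of \<open>u\<close> gives
  \<open>(1 - x) * u x\<close> from the left part and \<open>x * u x\<close> from the right part,
  the latter because the integral over [0,1] is zero.\<close>

lemma H01_reproducing:
  assumes u: "u \<in> H01" and x: "x \<in> \<Omega>"
  shows "H01_inner u (\<lambda>y. bridge_kernel y x) = u x"
proof -
  note d = H01_weak_deriv[OF u]
  define g where "g = weak_deriv u"
  note g = has_L2_derivativeD[OF d, folded g_def]
  define h where "h = (\<lambda>t. if t \<le> x then 1 - x else - x)"
  note k = bridge_kernel_deriv(1)[OF x, folded h_def]
  note h = has_L2_derivativeD[OF k]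
  have "integrable (lebesgue_on \<Omega>) (\<lambda>t. g t * h t)"
    by (rule integrable_mult_of_squares[OF g(1) h(1) g(2) h(2)])
  then have "H01_inner u (\<lambda>y. bridge_kernel y x) = integral {0..1} (\<lambda>t. g t * h t)"
    by (simp add: H01_inner_eq[OF d k] integrable_on_unit_interval(2) flip: g_def)
  also have "\<dots> = integral {0..x} g * (1 - x) + integral {x..1} g * (- x)"
  proof (rule integral_unique, rule has_integral_combine)
    have "(g has_integral integral {0..x} g) {0..x}" "(g has_integral integral {x..1} g) {x..1}"
      using x by (auto intro!: integrable_integral intro: integrable_subinterval_real[OF g(4)])
    note part = has_integral_mult_left[OF this(1), of "1 - x"] has_integral_mult_left[OF this(2), of "- x"]
    show "((\<lambda>t. g t * h t) has_integral integral {0..x} g * (1 - x)) {0..x}"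
      by (rule has_integral_spike_finite[OF _ _ part(1), of "{x}"]) (auto simp: h_def)
    show "((\<lambda>t. g t * h t) has_integral integral {x..1} g * (- x)) {x..1}"
      by (rule has_integral_spike_finite[OF _ _ part(2), of "{x}"]) (auto simp: h_def)
  qed (use x in auto)
  also have "\<dots> = u x"
    using integral_sub_initial[OF g(4), of x 1] H01_eq_integral[OF u d, folded g_def] x
    by (simp add: algebra_simps)
  finally show ?thesis .
qed

theorem bridge_kernel_rkhs: "is_rkhs \<Omega> bridge_kernel H01 H01_inner"
proof -
  have zero: "(\<lambda>_. 0) \<in> H01"
    by (rule H01_of_integral[of "\<lambda>_. 0"]) auto
  have cong: "v \<in> H01" if u: "u \<in> H01" and v: "\<forall>x\<in>\<Omega>. v x = u x" for u v
    using H01_eq_integral[OF u H01_weak_deriv[OF u]] has_L2_derivativeD(1,2)[OF H01_weak_deriv[OF u]] v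
    by (intro H01_of_integral(2)[of "weak_deriv u"]) auto
  show ?thesis
    unfolding is_rkhs_def
  proof (intro conjI ballI allI impI)
    fix u v w :: "real \<Rightarrow> real" and c :: real assume H: "u \<in> H01" "v \<in> H01"
    show "(\<lambda>x. u x + v x) \<in> H01" "(\<lambda>x. c * u x) \<in> H01"
      using H01_lincomb[OF H, of 1 1] H01_lincomb[OF H, of c 0] by simp_all
    show "H01_inner u v = H01_inner v u"
      by (rule H01_inner_commute)
    show "H01_inner (\<lambda>x. c * u x) v = c * H01_inner u v"
      using H01_inner_lincomb[OF H(1) H, of c 0] by simp
    assume "w \<in> H01"
    then show "H01_inner (\<lambda>x. u x + v x) w = H01_inner u w + H01_inner v w"
      using H01_inner_lincomb[OF H, of w 1 1] by simp
  next
    fix s :: "nat \<Rightarrow> real \<Rightarrow> real"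
    assume "(\<forall>n. s n \<in> H01) \<and> (\<forall>e>0. \<exists>N. \<forall>m\<ge>N. \<forall>n\<ge>N.
      sqrt (H01_inner (\<lambda>x. s m x - s n x) (\<lambda>x. s m x - s n x)) < e)"
    then show "\<exists>u\<in>H01. (\<lambda>n. sqrt (H01_inner (\<lambda>x. s n x - u x) (\<lambda>x. s n x - u x))) \<longlonglongrightarrow> 0"
      by (intro H01_complete) auto
  next
    fix u v assume "u \<in> H01" "\<forall>x\<in>\<Omega>. v x = u x"
    then show "v \<in> H01" by (rule cong)
  next
    fix u x assume "u \<in> H01" "x \<in> \<Omega>"
    then show "H01_inner u (\<lambda>y. bridge_kernel y x) = u x" by (rule H01_reproducing)
  next
    fix x :: real assume "x \<in> \<Omega>"
    then show "(\<lambda>y. bridge_kernel y x) \<in> H01" by (rule bridge_kernel_deriv)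
  qed (simp_all only: zero H01_inner_self_nonneg H01_inner_self_eq_0_iff)
qed

section \<open>The residual between two consecutive interpolation points\<close>

definition gap :: "real set \<Rightarrow> real \<Rightarrow> real \<Rightarrow> bool" where
  "gap X a b \<longleftrightarrow> a \<in> insert 0 X \<and> b \<in> insert 1 X \<and> a < b \<and> X \<inter> {a<..<b} = {}"

text \<open>The gap is half-open, so a point of \<open>X\<close> is assigned to the gap on its
  right; that choice later yields a zero residual at interpolation points.\<close>

lemma gap_exists:
  assumes "finite X" "X \<subseteq> \<Omega>" "y \<in> \<Omega>"
  obtains a b where "gap X a b" "a \<le> y" "y < b"
proof -
  define A B where "A = {z \<in> insert 0 X. z \<le> y}" and "B = {z \<in> insert 1 X. y < z}"
  have fin: "finite A" "finite B" and ne: "A \<noteq> {}" "B \<noteq> {}"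
    using assms by (auto simp: A_def B_def)
  have 1: "Max A \<in> A" "Min B \<in> B"
    using fin ne by auto
  have 2: "z \<le> Max A" if "z \<in> A" for z using that fin by simp
  have 3: "Min B \<le> z" if "z \<in> B" for z using that fin by simp
  have "X \<inter> {Max A<..<Min B} = {}"
  proof (rule ccontr)
    assume "X \<inter> {Max A<..<Min B} \<noteq> {}"
    then obtain z where "z \<in> X" "Max A < z" "z < Min B" by auto
    moreover from this have "z \<in> A \<or> z \<in> B" by (auto simp: A_def B_def)
    ultimately show False using 2[of z] 3[of z] by linarith
  qed
  then have "gap X (Max A) (Min B)" "Max A \<le> y" "y < Min B"
    using 1 unfolding gap_def by (auto simp: A_def B_def)
  then show ?thesis by (rule that)
qed

lemma gap_bounds: "X \<subseteq> \<Omega> \<Longrightarrow> gap X a b \<Longrightarrow> 0 \<le> a \<and> a < b \<and> b \<le> 1"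
  unfolding gap_def by auto

lemma gap_neighbours:
  assumes "finite X" "X \<subseteq> \<Omega>" "z \<in> \<Omega>" "z \<notin> X"
  obtains a b where "gap X a b" "a < z" "z < b"
proof -
  obtain a b where "gap X a b" "a \<le> z" "z < b"
    by (rule gap_exists[OF assms(1-3)])
  moreover from this have "a \<noteq> z"
    using assms(3,4) unfolding gap_def by auto
  ultimately show ?thesis
    using that by auto
qed

text \<open>The product terms of the three kernels cancel because
  \<open>(b - a) * z = (b - z) * a + (z - a) * b\<close>. What remains is a tent supported on [a,b]
  with height \<open>(z - a) * (b - z)\<close> at \<open>z\<close>, which is exactly the residual
  that insertion of \<open>z\<close> has to remove.\<close>

definition hat :: "real \<Rightarrow> real \<Rightarrow> real \<Rightarrow> real \<Rightarrow> real" where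
  "hat a z b y = (b - a) * bridge_kernel y z - (b - z) * bridge_kernel y a - (z - a) * bridge_kernel y b"

lemma hat_left: "a \<le> y \<Longrightarrow> y \<le> z \<Longrightarrow> z \<le> b \<Longrightarrow> hat a z b y = (y - a) * (b - z)"
  by (simp add: hat_def bridge_kernel_def min_absorb1 min_absorb2) (simp add: algebra_simps)

lemma hat_right: "z \<le> y \<Longrightarrow> y \<le> b \<Longrightarrow> a \<le> z \<Longrightarrow> hat a z b y = (z - a) * (b - y)"
  by (simp add: hat_def bridge_kernel_def min_absorb1 min_absorb2) (simp add: algebra_simps)

lemma hat_outside: "y \<le> a \<or> b \<le> y \<Longrightarrow> a \<le> z \<Longrightarrow> z \<le> b \<Longrightarrow> hat a z b y = 0"
  by (elim disjE; simp add: hat_def bridge_kernel_def min_absorb1 min_absorb2; simp add: algebra_simps)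

section \<open>Unisolvence of interpolation with the bridge kernel\<close>

lemma bridge_kernel_commute: "bridge_kernel x y = bridge_kernel y x"
  by (simp add: bridge_kernel_def min.commute mult.commute)

lemma bridge_kernel_0: "0 \<le> y \<Longrightarrow> bridge_kernel y 0 = 0"
  by (simp add: bridge_kernel_def)

lemma bridge_kernel_1: "y \<le> 1 \<Longrightarrow> bridge_kernel y 1 = 0"
  by (simp add: bridge_kernel_def)

text \<open>Testing a kernel sum against the hat function at \<open>p\<close>, a combination of three kernel
  translates that vanishes at the other points of \<open>X\<close>, isolates the coefficient at \<open>p\<close>.\<close>

lemma kernel_coefficients_zero:
  assumes X: "finite X" "X \<subseteq> \<Omega>" and zero: "\<And>y. y \<in> X \<Longrightarrow> (\<Sum>x\<in>X. c x * bridge_kernel y x) = 0"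
    and p: "p \<in> X"
  shows "c p = 0"
proof -
  obtain a b where ab: "gap (X - {p}) a b" "a < p" "p < b"
    using gap_neighbours[of "X - {p}" p] X p by blast
  define s where "s y = (\<Sum>x\<in>X. c x * bridge_kernel y x)" for y
  \<comment> \<open>A neighbour of \<open>p\<close> may be an end point of the interval; the kernel
    sum vanishes there as well.\<close>
  have end0: "bridge_kernel 0 x = 0" "bridge_kernel 1 x = 0" if "x \<in> X" for x
    using X(2) that by (auto simp: bridge_kernel_def)
  have "s 0 = 0" "s 1 = 0"
    using end0 unfolding s_def by (auto intro: sum.neutral)
  then have s0: "s a = 0" "s p = 0" "s b = 0"
    using ab(1) zero p unfolding gap_def s_def by auto
  have "0 = (b - a) * s p - (b - p) * s a - (p - a) * s b"
    by (simp add: s0)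
  \<comment> \<open>Symmetry of the kernel turns values of the sum at \<open>a\<close>,
    \<open>p\<close>, \<open>b\<close> into values of the hat function at the nodes.\<close>
  also have "\<dots> = (\<Sum>x\<in>X. c x * hat a p b x)"
    unfolding s_def sum_distrib_left sum_subtractf[symmetric]
    by (intro sum.cong refl) (simp add: hat_def bridge_kernel_commute[of a]
      bridge_kernel_commute[of p] bridge_kernel_commute[of b] algebra_simps)
  also have "\<dots> = (\<Sum>x\<in>X. if x = p then c p * ((p - a) * (b - p)) else 0)"
  proof (rule sum.cong)
    fix x assume x: "x \<in> X"
    have "x \<le> a \<or> b \<le> x" if "x \<noteq> p"
      using ab(1) x that unfolding gap_def by (auto simp: not_less[symmetric])
    then show "c x * hat a p b x = (if x = p then c p * ((p - a) * (b - p)) else 0)"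
      using hat_outside[of x a b p] hat_left[of a p p b] ab by auto
  qed simp
  also have "\<dots> = c p * ((p - a) * (b - p))"
    using X p by simp
  finally show ?thesis
    using ab by simp
qed

text \<open>Two interpolating combinations differ by one that vanishes on \<open>X\<close>, so their
  coefficients agree. Any explicit interpolating combination thus identifies the definite
  description, even as a function on the whole line.\<close>

lemma interpolant_eqI:
  assumes X: "finite X" "X \<subseteq> \<Omega>"
    and int: "\<And>y. y \<in> X \<Longrightarrow> (\<Sum>x\<in>X. c x * bridge_kernel y x) = f y"
  shows "interpolant bridge_kernel X f = (\<lambda>y. \<Sum>x\<in>X. c x * bridge_kernel y x)"
  unfolding interpolant_def
proof (rule the_equality)
  show "(\<lambda>y. \<Sum>x\<in>X. c x * bridge_kernel y x) \<in> kernel_span bridge_kernel X \<and>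
      (\<forall>x\<in>X. (\<Sum>xa\<in>X. c xa * bridge_kernel x xa) = f x)"
    using int unfolding kernel_span_def by auto
next
  fix s assume "s \<in> kernel_span bridge_kernel X \<and> (\<forall>x\<in>X. s x = f x)"
  then obtain d where s: "s = (\<lambda>y. \<Sum>x\<in>X. d x * bridge_kernel y x)" and sf: "\<And>x. x \<in> X \<Longrightarrow> s x = f x"
    unfolding kernel_span_def by auto
  have "d p - c p = 0" if "p \<in> X" for p
    by (rule kernel_coefficients_zero[OF X _ that])
      (use sf int s in \<open>simp add: left_diff_distrib sum_subtractf\<close>)
  then have "d p = c p" if "p \<in> X" for p
    using that by simp
  then show "s = (\<lambda>y. \<Sum>x\<in>X. c x * bridge_kernel y x)"
    unfolding s by (intro ext sum.cong) auto
qed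

text \<open>A gap of the enlarged set is one of the two parts of \<open>(a, b)\<close> or an old gap
  away from \<open>z\<close>. On the left part the claim is
  \<open>(y - a) * (z - y) = (y - a) * (b - y) - (y - a) * (b - z)\<close>, the right part is
  symmetric, and elsewhere the hat function vanishes.\<close>

lemma gap_insert:
  assumes X: "X \<subseteq> \<Omega>" and ab: "gap X a b" "a < z" "z < b"
    and g: "gap (insert z X) a' b'" and y: "a' \<le> y" "y \<le> b'"
  obtains a'' b'' where "gap X a'' b''" "a'' \<le> y" "y \<le> b''"
    "(y - a') * (b' - y) = (y - a'') * (b'' - y) - hat a z b y"
proof -
  have bd: "0 \<le> a" "b \<le> 1" "0 < z" "z < 1"
    using gap_bounds[OF X ab(1)] ab by auto
  then have bd': "0 \<le> a'" "b' \<le> 1"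
    using gap_bounds[OF _ g] X by auto
  have in1: False if "x \<in> X" "a < x" "x < b" for x
    using ab(1) that unfolding gap_def by (simp add: disjoint_iff)
  have in2: False if "x \<in> insert z X" "a' < x" "x < b'" for x
  proof -
    have "x \<in> insert z X \<inter> {a'<..<b'}"
      using that by simp
    then show False
      using g unfolding gap_def by simp
  qed
  have ends: "a = 0 \<or> a \<in> X" "b = 1 \<or> b \<in> X" "a' = 0 \<or> a' \<in> insert z X" "b' = 1 \<or> b' \<in> insert z X"
    and less: "a' < b'"
    using ab(1) g unfolding gap_def by simp_all
  consider (left) "b' = z" | (right) "a' = z" | (other) "a' \<noteq> z" "b' \<noteq> z" by blast
  then show ?thesis
  proof cases
    case left
    have "\<not> a' < a"
      using in2[of a] ends(1) ab left bd' by fastforce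
    moreover have "\<not> a < a'"
      using in1[of a'] ends(3) ab left less bd by fastforce
    ultimately have a: "a' = a" by simp
    have h: "hat a z b y = (y - a) * (b - z)"
      using y ab unfolding a left by (intro hat_left) auto
    show ?thesis
    proof (rule that[OF ab(1)])
      show "a \<le> y" "y \<le> b"
        using y ab unfolding a left by auto
      show "(y - a') * (b' - y) = (y - a) * (b - y) - hat a z b y"
        unfolding h a left by (simp add: algebra_simps)
    qed
  next
    case right
    have "\<not> b < b'"
      using in2[of b] ends(2) ab right bd' by fastforce
    moreover have "\<not> b' < b"
      using in1[of b'] ends(4) ab right less bd by fastforce
    ultimately have b: "b' = b" by simp
    have h: "hat a z b y = (z - a) * (b - y)"
      using y ab unfolding b right by (intro hat_right) auto
    show ?thesis
    proof (rule that[OF ab(1)])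
      show "a \<le> y" "y \<le> b"
        using y ab unfolding b right by auto
      show "(y - a') * (b' - y) = (y - a) * (b - y) - hat a z b y"
        unfolding h b right by (simp add: algebra_simps)
    qed
  next
    case other
    have g': "gap X a' b'"
      using ends(3,4) less other in2 unfolding gap_def by (simp add: disjoint_iff) blast
    have "b' \<le> a \<or> b \<le> a'"
    proof (rule ccontr)
      \<comment> \<open>Neither end of the new gap can lie strictly inside \<open>(a, b)\<close>, so
        an overlapping gap would cover all of it and contain \<open>z\<close>.\<close>
      assume "\<not> ?thesis"
      moreover have "\<not> (a < a' \<and> a' < b)" "\<not> (a < b' \<and> b' < b)"
        using in1[of a'] in1[of b'] ends(3,4) other bd bd' ab by fastforce+
      ultimately have "a' < z" "z < b'"
        using ab by linarith+
      then show False
        using in2[of z] by simp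
    qed
    then have "hat a z b y = 0"
      using y ab by (intro hat_outside) auto
    then show ?thesis
      by (intro that[OF g' y]) simp
  qed
qed

text \<open>Induction over the points. Without points the only gap is (0,1), where the formula is
  the parabola itself; each further point adds a hat function to the interpolant.\<close>

lemma parabola_coefficients:
  assumes "finite X" "X \<subseteq> \<Omega>"
  shows "\<exists>c. \<forall>a b y. gap X a b \<longrightarrow> a \<le> y \<longrightarrow> y \<le> b \<longrightarrow>
    parabola y - (\<Sum>x\<in>X. c x * bridge_kernel y x) = (y - a) * (b - y)"
  using assms
proof (induction X rule: finite_induct)
  case empty
  then show ?case by (auto simp: gap_def parabola_def)
next
  case (insert z X)
  then have X: "finite X" "X \<subseteq> \<Omega>" "z \<in> \<Omega>" "z \<notin> X" by auto
  obtain c where c: "\<And>a b y. gap X a b \<Longrightarrow> a \<le> y \<Longrightarrow> y \<le> b \<Longrightarrow>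
      parabola y - (\<Sum>x\<in>X. c x * bridge_kernel y x) = (y - a) * (b - y)"
    using insert.IH[OF X(2)] by blast
  obtain a b where ab: "gap X a b" "a < z" "z < b"
    by (rule gap_neighbours[OF X])
  \<comment> \<open>The coefficients of the hat function are merged into \<open>c\<close>. If
    \<open>a = 0\<close> or \<open>b = 1\<close>, the corresponding correction never applies to a
    point of \<open>X\<close>; the missing term is zero for arguments in [0,1].\<close>
  define c' where "c' x = (if x = z then b - a else
      c x - (if x = a then b - z else 0) - (if x = b then z - a else 0))" for x
  have sum: "(\<Sum>x\<in>insert z X. c' x * bridge_kernel y x) = (\<Sum>x\<in>X. c x * bridge_kernel y x) + hat a z b y"
    if y: "0 \<le> y" "y \<le> 1" for y
  proof -
    have "(\<Sum>x\<in>X. c' x * bridge_kernel y x) = (\<Sum>x\<in>X. c x * bridge_kernel y x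
        - (if x = a then (b - z) * bridge_kernel y a else 0)
        - (if x = b then (z - a) * bridge_kernel y b else 0))"
      using X(4) by (intro sum.cong) (auto simp: c'_def algebra_simps)
    also have "\<dots> = (\<Sum>x\<in>X. c x * bridge_kernel y x)
        - (if a \<in> X then (b - z) * bridge_kernel y a else 0)
        - (if b \<in> X then (z - a) * bridge_kernel y b else 0)"
      using X(1) by (simp add: sum_subtractf)
    also have "\<dots> = (\<Sum>x\<in>X. c x * bridge_kernel y x)
        - (b - z) * bridge_kernel y a - (z - a) * bridge_kernel y b"
      using ab(1) bridge_kernel_0[OF y(1)] bridge_kernel_1[OF y(2)] unfolding gap_def by auto
    finally show ?thesis
      using X(1,4) by (simp add: c'_def hat_def)
  qed
  have "parabola y - (\<Sum>x\<in>insert z X. c' x * bridge_kernel y x) = (y - a') * (b' - y)"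
    if g: "gap (insert z X) a' b'" and y: "a' \<le> y" "y \<le> b'" for a' b' y
  proof -
    have "0 \<le> y" "y \<le> 1"
      using gap_bounds[OF insert.prems g] y by auto
    moreover obtain a'' b'' where "gap X a'' b''" "a'' \<le> y" "y \<le> b''"
      "(y - a') * (b' - y) = (y - a'') * (b'' - y) - hat a z b y"
      by (rule gap_insert[OF X(2) ab g y])
    ultimately show ?thesis
      using c[of a'' b'' y] by (simp add: sum)
  qed
  then show ?case by blast
qed

text \<open>Both descriptions are kept: the kernel sum gives continuity and membership in
  \<open>H01\<close>, the gap formula gives the values.\<close>

lemma residual_parabola:
  assumes X: "finite X" "X \<subseteq> \<Omega>"
  shows "\<exists>c. residual bridge_kernel X parabola = (\<lambda>y. parabola y - (\<Sum>x\<in>X. c x * bridge_kernel y x)) \<and>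
    (\<forall>a b y. gap X a b \<longrightarrow> a \<le> y \<longrightarrow> y \<le> b \<longrightarrow>
      residual bridge_kernel X parabola y = (y - a) * (b - y))"
proof -
  obtain c where c: "\<And>a b y. gap X a b \<Longrightarrow> a \<le> y \<Longrightarrow> y \<le> b \<Longrightarrow>
      parabola y - (\<Sum>x\<in>X. c x * bridge_kernel y x) = (y - a) * (b - y)"
    using parabola_coefficients[OF X] by blast
  have int: "(\<Sum>x\<in>X. c x * bridge_kernel y x) = parabola y" if y: "y \<in> X" for y
  proof -
    have "y \<in> \<Omega>"
      using X y by blast
    then obtain a b where ab: "gap X a b" "a \<le> y" "y < b"
      by (rule gap_exists[OF X])
    then have "a = y"
      using y unfolding gap_def by auto
    then show ?thesis
      using c[OF ab(1), of y] ab by simp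
  qed
  have r: "residual bridge_kernel X parabola = (\<lambda>y. parabola y - (\<Sum>x\<in>X. c x * bridge_kernel y x))"
    by (simp add: residual_def interpolant_eqI[OF X int])
  show ?thesis
    by (rule exI[of _ c]) (simp add: r c)
qed

lemma residual_on_gap:
  assumes "finite X" "X \<subseteq> \<Omega>" "gap X a b" "a \<le> y" "y \<le> b"
  shows "residual bridge_kernel X parabola y = (y - a) * (b - y)"
  using residual_parabola[OF assms(1,2)] assms(3-5) by blast

lemma residual_continuous:
  assumes "finite X" "X \<subseteq> \<Omega>"
  shows "continuous_on A (residual bridge_kernel X parabola)"
proof -
  obtain c where c: "residual bridge_kernel X parabola = (\<lambda>y. parabola y - (\<Sum>x\<in>X. c x * bridge_kernel y x))"
    using residual_parabola[OF assms] by blast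
  show ?thesis
    unfolding c parabola_def bridge_kernel_def by (intro continuous_intros)
qed

section \<open>Uniform norms\<close>

text \<open>For a continuous function a smaller essential bound would leave a nonempty open set
  where it is exceeded, and such a set is not negligible.\<close>

lemma Linf_norm_eqI:
  assumes cont: "continuous_on \<Omega> u" and le: "\<And>y. y \<in> \<Omega> \<Longrightarrow> \<bar>u y\<bar> \<le> m"
    and p: "p \<in> \<Omega>" "\<bar>u p\<bar> = m"
  shows "Linf_norm u = m"
proof -
  let ?M = "lebesgue_on \<Omega>"
  have "u \<in> borel_measurable ?M"
    by (rule continuous_imp_measurable_on_sets_lebesgue[OF cont]) simp
  then have meas: "(\<lambda>x. ereal \<bar>u x\<bar>) \<in> borel_measurable ?M"
    by measurable
  have "esssup ?M (\<lambda>x. ereal \<bar>u x\<bar>) \<le> ereal m"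
    by (rule esssup_I[OF meas]) (use le in \<open>auto intro!: AE_I2\<close>)
  moreover have "ereal m \<le> esssup ?M (\<lambda>x. ereal \<bar>u x\<bar>)"
  proof (rule ccontr)
    assume "\<not> ?thesis"
    then have "esssup ?M (\<lambda>x. ereal \<bar>u x\<bar>) < ereal m"
      by simp
    from ereal_dense2[OF this] obtain r where r: "esssup ?M (\<lambda>x. ereal \<bar>u x\<bar>) < ereal r" "r < m"
      by auto
    define S where "S = {x \<in> \<Omega>. r < \<bar>u x\<bar>}"
    have "open S"
      unfolding S_def
    proof -
      have "open ((\<lambda>x. \<bar>u x\<bar>) -` {r<..} \<inter> \<Omega>)"
        using continuous_on_open_vimage[of \<Omega> "\<lambda>x. \<bar>u x\<bar>"] continuous_on_rabs[OF cont] by simp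
      moreover have "(\<lambda>x. \<bar>u x\<bar>) -` {r<..} \<inter> \<Omega> = {x \<in> \<Omega>. r < \<bar>u x\<bar>}"
        by auto
      ultimately show "open {x \<in> \<Omega>. r < \<bar>u x\<bar>}"
        by (simp only:)
    qed
    moreover have "p \<in> S"
      using p r by (simp add: S_def)
    moreover have "negligible S"
    proof -
      have "AE x in ?M. ereal \<bar>u x\<bar> \<le> esssup ?M (\<lambda>x. ereal \<bar>u x\<bar>)"
        by (rule esssup_AE)
      then have "AE x in ?M. \<not> r < \<bar>u x\<bar>"
      proof eventually_elim
        case (elim x)
        then have "ereal \<bar>u x\<bar> < ereal r"
          using r(1) by (rule le_less_trans)
        then show ?case by simp
      qed
      then have "AE x in lebesgue. x \<in> \<Omega> \<longrightarrow> \<not> r < \<bar>u x\<bar>"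
        by (simp add: AE_restrict_space_iff)
      then have "AE x in lebesgue. x \<notin> S"
        by eventually_elim (auto simp: S_def)
      then show ?thesis
        using AE_iff_null_sets[of S lebesgue] \<open>open S\<close> by (simp add: negligible_iff_null_sets)
    qed
    ultimately show False
      using open_not_negligible by blast
  qed
  ultimately show ?thesis
    by (simp add: Linf_norm_def order_antisym)
qed

text \<open>Completing the square shows at once the maximum and that only the midpoint attains
  it.\<close>

lemma parabola_between: "(y - a) * (b - y) = ((b - a) / 2)\<^sup>2 - (y - (a + b) / 2)\<^sup>2" for a b y :: real
  by (simp add: power2_eq_square field_simps)

lemma Linf_norm_residual:
  assumes X: "finite X" "X \<subseteq> \<Omega>"
  obtains a b where "gap X a b" "Linf_norm (residual bridge_kernel X parabola) = ((b - a) / 2)\<^sup>2"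
    "\<forall>a' b'. gap X a' b' \<longrightarrow> b' - a' \<le> b - a"
proof -
  \<comment> \<open>The gaps are pairs from a finite product, so a longest one exists.\<close>
  define P where "P = {p. gap X (fst p) (snd p)}"
  define len where "len p = snd p - fst p" for p :: "real \<times> real"
  have "P \<subseteq> insert 0 X \<times> insert 1 X"
  proof
    fix p assume "p \<in> P"
    then show "p \<in> insert 0 X \<times> insert 1 X"
      unfolding P_def gap_def by (simp only: mem_Collect_eq mem_Times_iff)
  qed
  then have "finite P"
    by (rule finite_subset) (intro finite_cartesian_product finite.insertI X(1))
  then have fin: "finite (len ` P)"
    by (rule finite_imageI)
  have "(1 / 2 :: real) \<in> \<Omega>"
    by simp
  then obtain a0 b0 where "gap X a0 b0" "a0 \<le> 1 / 2" "1 / 2 < b0"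
    by (rule gap_exists[OF X])
  then have "(a0, b0) \<in> P"
    unfolding P_def by simp
  then have "Max (len ` P) \<in> len ` P"
    by (intro Max_in[OF fin]) blast
  then obtain p where p: "p \<in> P" "Max (len ` P) = len p"
    by (rule imageE)
  define a b where "a = fst p" and "b = snd p"
  have ab: "gap X a b"
    using p(1) unfolding P_def a_def b_def by simp
  have max: "b' - a' \<le> b - a" if "gap X a' b'" for a' b'
  proof -
    have "len (a', b') \<le> len p"
      unfolding p(2)[symmetric] by (rule Max_ge[OF fin imageI]) (simp add: P_def that)
    then show ?thesis
      by (simp add: len_def a_def b_def)
  qed
  have bd: "0 \<le> a" "a < b" "b \<le> 1"
    using gap_bounds[OF X(2) ab] by auto
  have "Linf_norm (residual bridge_kernel X parabola) = ((b - a) / 2)\<^sup>2"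
  proof (rule Linf_norm_eqI[where p="(a + b) / 2"])
    show "\<bar>residual bridge_kernel X parabola ((a + b) / 2)\<bar> = ((b - a) / 2)\<^sup>2"
      using residual_on_gap[OF X ab, of "(a + b) / 2"] parabola_between[of "(a + b) / 2" a b] bd
      by (simp del: diff_divide_distrib)
    fix y assume y: "y \<in> \<Omega>"
    then obtain a' b' where g: "gap X a' b'" "a' \<le> y" "y < b'"
      by (rule gap_exists[OF X])
    have "((b' - a') / 2)\<^sup>2 \<le> ((b - a) / 2)\<^sup>2"
      using max[OF g(1)] g by (intro power_mono) auto
    moreover have "residual bridge_kernel X parabola y = (y - a') * (b' - y)"
      using g by (intro residual_on_gap[OF X]) auto
    moreover have "0 \<le> (y - a') * (b' - y)"
      using g by simp
    moreover have "(y - a') * (b' - y) \<le> ((b' - a') / 2)\<^sup>2"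
      by (simp add: parabola_between)
    ultimately show "\<bar>residual bridge_kernel X parabola y\<bar> \<le> ((b - a) / 2)\<^sup>2"
      by linarith
  next
    show "(a + b) / 2 \<in> \<Omega>"
      using bd by simp
  qed (rule residual_continuous[OF X])
  then show ?thesis
    using that[OF ab] max by simp
qed

section \<open>Energy norms\<close>

text \<open>\<open>has_L2_derivative\<close> inspects values on \<open>\<Omega>\<close> only, so
  both choices are made from the same predicate and coincide literally.\<close>

lemma weak_deriv_cong:
  assumes "\<And>x. x \<in> \<Omega> \<Longrightarrow> u x = v x"
  shows "weak_deriv u = weak_deriv v"
proof -
  have "has_L2_derivative u = has_L2_derivative v"
    unfolding has_L2_derivative_def fun_eq_iff using assms by simp
  then show ?thesis
    by (simp add: weak_deriv_def)
qed

lemma H01_inner_cong: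
  assumes "\<And>x. x \<in> \<Omega> \<Longrightarrow> u x = u' x" "\<And>x. x \<in> \<Omega> \<Longrightarrow> v x = v' x"
  shows "H01_inner u v = H01_inner u' v'"
  using weak_deriv_cong[of u u'] weak_deriv_cong[of v v'] assms by (simp add: H01_inner_def)

lemma bridge_kernel_in_H01:
  assumes "0 \<le> x" "x \<le> 1"
  shows "(\<lambda>y. bridge_kernel y x) \<in> H01"
proof (cases "x \<in> \<Omega>")
  case True
  then show ?thesis by (rule bridge_kernel_deriv)
next
  case False
  then have "x = 0 \<or> x = 1"
    using assms by auto
  then have "bridge_kernel y x = 0" if "y \<in> \<Omega>" for y
    using that bridge_kernel_0[of y] bridge_kernel_1[of y] by auto
  then show ?thesis
    by (intro H01_of_integral(2)[of "\<lambda>_. 0"]) auto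
qed

text \<open>The kernel translates at the end points of the interval vanish, so reproduction holds there
  if the value of \<open>u\<close> is zero.\<close>

lemma H01_reproducing_closed:
  assumes u: "u \<in> H01" and x: "0 \<le> x" "x \<le> 1" and "x \<notin> \<Omega> \<Longrightarrow> u x = 0"
  shows "H01_inner (\<lambda>y. bridge_kernel y x) u = u x"
proof (cases "x \<in> \<Omega>")
  case True
  then show ?thesis
    using H01_reproducing[OF u] H01_inner_commute by metis
next
  case False
  then have "x = 0 \<or> x = 1"
    using x by auto
  then have *: "bridge_kernel y x = 0" if "y \<in> \<Omega>" for y
    using that bridge_kernel_0[of y] bridge_kernel_1[of y] by auto
  have "has_L2_derivative (\<lambda>y. bridge_kernel y x) (\<lambda>_. 0)"
    by (rule H01_of_integral(1)) (use * in auto)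
  from H01_inner_eq[OF this H01_weak_deriv[OF u]] show ?thesis
    using assms(4) False by simp
qed

lemma hat_in_H01:
  assumes "0 \<le> a" "a \<le> z" "z \<le> b" "b \<le> 1"
  shows "hat a z b \<in> H01"
proof -
  have k: "(\<lambda>y. bridge_kernel y a) \<in> H01" "(\<lambda>y. bridge_kernel y z) \<in> H01" "(\<lambda>y. bridge_kernel y b) \<in> H01"
    using assms by (auto intro!: bridge_kernel_in_H01)
  have "hat a z b = (\<lambda>y. 1 * ((b - a) * bridge_kernel y z + (- (b - z)) * bridge_kernel y a)
      + (- (z - a)) * bridge_kernel y b)"
    unfolding hat_def fun_eq_iff by (simp add: algebra_simps)
  then show ?thesis
    using H01_lincomb[OF H01_lincomb[OF k(2,1)] k(3), of 1 "b - a" "- (b - z)" "- (z - a)"] by simp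
qed

text \<open>Reproduction turns the pairing with a hat function into a divided-difference type
  expression. The condition \<open>zero\<close> fixes the values of \<open>u\<close> at end points,
  which membership in \<open>H01\<close> leaves open.\<close>

lemma H01_inner_hat:
  assumes ord: "0 \<le> a" "a \<le> z" "z \<le> b" "b \<le> 1" and u: "u \<in> H01"
    and zero: "\<And>x. x \<in> {a, z, b} \<Longrightarrow> x \<notin> \<Omega> \<Longrightarrow> u x = 0"
  shows "H01_inner (hat a z b) u = (b - a) * u z - (b - z) * u a - (z - a) * u b"
proof -
  have k: "(\<lambda>y. bridge_kernel y a) \<in> H01" "(\<lambda>y. bridge_kernel y z) \<in> H01" "(\<lambda>y. bridge_kernel y b) \<in> H01"
    using ord by (auto intro!: bridge_kernel_in_H01)
  have r: "H01_inner (\<lambda>y. bridge_kernel y a) u = u a" "H01_inner (\<lambda>y. bridge_kernel y z) u = u z"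
    "H01_inner (\<lambda>y. bridge_kernel y b) u = u b"
    by (rule H01_reproducing_closed[OF u]; use ord zero[of a] zero[of z] zero[of b] in simp)+
  have h: "hat a z b = (\<lambda>y. 1 * ((b - a) * bridge_kernel y z + (- (b - z)) * bridge_kernel y a)
      + (- (z - a)) * bridge_kernel y b)"
    unfolding hat_def fun_eq_iff by (simp add: algebra_simps)
  show ?thesis
    unfolding h H01_inner_lincomb[OF H01_lincomb[OF k(2,1)] k(3) u] H01_inner_lincomb[OF k(2,1) u] r
    by (simp add: algebra_simps)
qed

section \<open>Energy of the parabola and energy loss per inserted point\<close>

lemma parabola_H01: "has_L2_derivative parabola (\<lambda>t. 1 - 2 * t)" "parabola \<in> H01"
proof -
  let ?g = "\<lambda>t::real. 1 - 2 * t"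
  have m: "?g \<in> borel_measurable (lebesgue_on \<Omega>)"
    by (rule continuous_imp_measurable_on_sets_lebesgue) (auto intro!: continuous_intros)
  have i: "integrable (lebesgue_on \<Omega>) (\<lambda>t. (?g t)\<^sup>2)"
  proof (rule finite_measure.integrable_const_bound[OF finite_measure_unit_interval, where B=1])
    show "AE t in lebesgue_on \<Omega>. norm ((1 - 2 * t)\<^sup>2) \<le> 1"
      by (rule AE_I2) (simp add: abs_square_le_1 abs_le_iff)
  qed (use m in measurable)
  have int: "(?g has_integral parabola x) {0..x}" if "0 \<le> x" for x
  proof -
    have "(?g has_integral parabola x - parabola 0) {0..x}"
      unfolding parabola_def
      by (rule fundamental_theorem_of_calculus[OF that])
        (auto intro!: derivative_eq_intros simp: has_real_derivative_iff_has_vector_derivative[symmetric])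
    then show ?thesis by (simp add: parabola_def)
  qed
  have "integral {0..1} ?g = 0" "\<And>x. x \<in> \<Omega> \<Longrightarrow> parabola x = integral {0..x} ?g"
    using integral_unique[OF int] by (auto simp: parabola_def)
  then show "has_L2_derivative parabola ?g" "parabola \<in> H01"
    using H01_of_integral[OF m i] by blast+
qed

lemma parabola_energy: "H01_inner parabola parabola = 1 / 3"
proof -
  note g = has_L2_derivativeD[OF parabola_H01(1)]
  have "H01_inner parabola parabola = integral {0..1} (\<lambda>t::real. (1 - 2 * t)\<^sup>2)"
    using H01_inner_self[OF parabola_H01(1)] integrable_on_unit_interval(2)[OF g(2)] by simp
  also have "\<dots> = 1 / 3"
  proof -
    have "((\<lambda>t::real. (1 - 2 * t)\<^sup>2) has_integral (- ((1 - 2 * 1) ^ 3) / 6 - (- ((1 - 2 * 0) ^ 3) / 6))) {0..1}"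
      by (rule fundamental_theorem_of_calculus)
        (auto intro!: derivative_eq_intros simp: has_real_derivative_iff_has_vector_derivative[symmetric] power2_eq_square)
    then show ?thesis
      by (simp add: integral_unique)
  qed
  finally show ?thesis .
qed

lemma residual_in_H01:
  assumes "finite X" "X \<subseteq> \<Omega>"
  shows "residual bridge_kernel X parabola \<in> H01"
proof -
  obtain c where c: "residual bridge_kernel X parabola = (\<lambda>y. parabola y - (\<Sum>x\<in>X. c x * bridge_kernel y x))"
    using residual_parabola[OF assms] by blast
  have "(\<lambda>y. parabola y - (\<Sum>x\<in>X. c x * bridge_kernel y x)) \<in> H01"
    using assms
  proof (induction X rule: finite_induct)
    case empty
    then show ?case using parabola_H01 by simp
  next
    case (insert z X)
    have "(\<lambda>y. bridge_kernel y z) \<in> H01"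
      using insert.prems by (intro bridge_kernel_in_H01) auto
    with insert show ?case
      using H01_lincomb[of "\<lambda>y. parabola y - (\<Sum>x\<in>X. c x * bridge_kernel y x)" "\<lambda>y. bridge_kernel y z" 1 "- c z"]
      by (simp add: diff_diff_eq algebra_simps)
  qed
  then show ?thesis
    by (simp only: c)
qed

definition energy :: "real set \<Rightarrow> real" where
  "energy X = H01_inner (residual bridge_kernel X parabola) (residual bridge_kernel X parabola)"

lemma energy_empty: "energy {} = 1 / 3"
proof -
  have "residual bridge_kernel {} parabola = parabola"
    using residual_parabola[of "{}"] by auto
  then show ?thesis
    by (simp add: energy_def parabola_energy)
qed

text \<open>Pythagoras: the residual \<open>R\<close> and the hat function \<open>h\<close> both
  vanish at \<open>a\<close> and \<open>b\<close> and agree at \<open>z\<close>, so \<open>h\<close>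
  has the same inner product with \<open>R\<close> as with itself. Hence \<open>R - h\<close> is
  orthogonal to \<open>h\<close>, and the loss is the energy of \<open>h\<close>.\<close>

lemma energy_insert:
  assumes X: "finite X" "X \<subseteq> \<Omega>" and ab: "gap X a b" "a < z" "z < b"
  shows "energy (insert z X) = energy X - (b - a) * (z - a) * (b - z)"
proof -
  define R h where "R = residual bridge_kernel X parabola" and "h = hat a z b"
  have bd: "0 \<le> a" "a \<le> z" "z \<le> b" "b \<le> 1" "z \<in> \<Omega>"
    using gap_bounds[OF X(2) ab(1)] ab by auto
  have X': "finite (insert z X)" "insert z X \<subseteq> \<Omega>"
    using X bd by auto
  have RH: "R \<in> H01" and hH: "h \<in> H01"
    unfolding R_def h_def using residual_in_H01[OF X] hat_in_H01 bd by auto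
  \<comment> \<open>The gap formula describes the residual on [0,1] only, so the difference is
    established on \<open>\<Omega>\<close> and transferred by \<open>H01_inner_cong\<close>.\<close>
  have R': "residual bridge_kernel (insert z X) parabola y = R y - h y" if y: "y \<in> \<Omega>" for y
  proof -
    obtain a' b' where g: "gap (insert z X) a' b'" "a' \<le> y" "y < b'"
      by (rule gap_exists[OF X' y])
    have y': "y \<le> b'"
      using g by simp
    obtain a'' b'' where "gap X a'' b''" "a'' \<le> y" "y \<le> b''"
      "(y - a') * (b' - y) = (y - a'') * (b'' - y) - hat a z b y"
      by (rule gap_insert[OF X(2) ab g(1,2) y'])
    then show ?thesis
      using residual_on_gap[OF X' g(1,2) y'] residual_on_gap[OF X, of a'' b'' y]
      by (simp add: R_def h_def)
  qed
  have R_val: "R z = (z - a) * (b - z)" "R a = 0" "R b = 0"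
    unfolding R_def using residual_on_gap[OF X ab(1)] ab by auto
  have h_val: "h z = (z - a) * (b - z)" "h a = 0" "h b = 0"
    unfolding h_def using hat_left[of a z z b] hat_outside[of a a b z] hat_outside[of b a b z] bd by auto
  have hR: "H01_inner h R = (b - a) * ((z - a) * (b - z))"
    unfolding h_def using R_val bd by (subst H01_inner_hat[OF _ _ _ _ RH]) auto
  have hh: "H01_inner h h = (b - a) * ((z - a) * (b - z))"
    using h_val bd unfolding h_def by (subst H01_inner_hat[OF _ _ _ _ hH[unfolded h_def]]) auto
  have d: "(\<lambda>y. R y - h y) = (\<lambda>y. 1 * R y + (- 1) * h y)"
    by simp
  have dH: "(\<lambda>y. R y - h y) \<in> H01"
    unfolding d by (rule H01_lincomb[OF RH hH])
  have "energy (insert z X) = H01_inner (\<lambda>y. R y - h y) (\<lambda>y. R y - h y)"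
    unfolding energy_def by (rule H01_inner_cong) (use R' in auto)
  also have "\<dots> = H01_inner R (\<lambda>y. R y - h y) - H01_inner h (\<lambda>y. R y - h y)"
    using H01_inner_lincomb[OF RH hH dH, of 1 "-1"] by simp
  also have "\<dots> = H01_inner (\<lambda>y. R y - h y) R - H01_inner (\<lambda>y. R y - h y) h"
    by (simp only: H01_inner_commute[of R] H01_inner_commute[of h])
  also have "\<dots> = (H01_inner R R - H01_inner h R) - (H01_inner R h - H01_inner h h)"
    using H01_inner_lincomb[OF RH hH RH, of 1 "-1"] H01_inner_lincomb[OF RH hH hH, of 1 "-1"] by simp
  also have "\<dots> = energy X - (b - a) * (z - a) * (b - z)"
    by (simp add: H01_inner_commute[of R h] hR hh energy_def R_def[symmetric] algebra_simps)
  finally show ?thesis .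
qed

section \<open>Uniform grids\<close>

text \<open>Indexed by the number of cells, one more than the number of points, so that bisecting
  every cell doubles the index; \<open>grid 1\<close> is empty.\<close>

definition grid :: "nat \<Rightarrow> real set" where
  "grid N = {real i / real N | i. 1 \<le> i \<and> i < N}"

definition midpoints :: "nat \<Rightarrow> real set" where
  "midpoints N = {(2 * real i + 1) / (2 * real N) | i. i < N}"

lemma equi_points_grid: "equi_points n = grid (n + 1)"
  unfolding equi_points_def grid_def by (rule Collect_cong) (auto simp: less_Suc_eq_le)

lemma grid_image: "grid N = (\<lambda>i. real i / real N) ` {1..<N}"
  unfolding grid_def by auto

lemma midpoints_image: "midpoints N = (\<lambda>i. (2 * real i + 1) / (2 * real N)) ` {..<N}"
  unfolding midpoints_def by auto

lemma finite_grid: "finite (grid N)" and finite_midpoints: "finite (midpoints N)"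
  by (simp_all add: grid_image midpoints_image)

lemma card_grid: "card (grid N) = N - 1"
  unfolding grid_image by (subst card_image) (auto simp: inj_on_def)

lemma card_midpoints: "card (midpoints N) = N"
  unfolding midpoints_image by (subst card_image) (auto simp: inj_on_def)

lemma grid_subset: "grid N \<subseteq> \<Omega>"
  unfolding grid_image by (auto simp: field_simps)

lemma midpoints_subset: "midpoints N \<subseteq> \<Omega>"
  unfolding midpoints_image by (auto simp: field_simps)

lemma grid_cell_disjoint:
  assumes "i < N"
  shows "grid N \<inter> {real i / real N<..<(real i + 1) / real N} = {}"
proof -
  have False if "x \<in> grid N" "real i / real N < x" "x < (real i + 1) / real N" for x
  proof -
    obtain j where "x = real j / real N"
      using \<open>x \<in> grid N\<close> unfolding grid_def by auto
    then have "real i < real j" "real j < real (i + 1)"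
      using that(2,3) assms by (simp_all add: divide_less_cancel add.commute)
    then show False by simp
  qed
  then show ?thesis by auto
qed

lemma midpoints_cell:
  assumes "i < N" and x: "x \<in> midpoints N" "real i / real N < x" "x < (real i + 1) / real N"
  shows "x = (2 * real i + 1) / (2 * real N)"
proof -
  obtain j where j: "x = (2 * real j + 1) / (2 * real N)"
    using \<open>x \<in> midpoints N\<close> unfolding midpoints_def by auto
  have "x = (real j + 1 / 2) / real N"
    using assms(1) unfolding j by (simp add: field_simps)
  then have "real i < real j + 1 / 2" "real j + 1 / 2 < real i + 1"
    using x(2,3) assms(1) by (simp_all add: divide_less_cancel)
  then have "real i < real (j + 1)" "real j < real (i + 1)"
    by simp_all
  then have "i = j" by simp
  then show ?thesis
    using j by simp
qed

lemma midpoint_in_cell: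
  assumes "i < N"
  shows "real i / real N < (2 * real i + 1) / (2 * real N)" "(2 * real i + 1) / (2 * real N) < (real i + 1) / real N"
  using assms by (simp_all add: field_simps)

lemma grid_midpoints_disjoint: "grid N \<inter> midpoints N = {}"
proof -
  have False if g: "x \<in> grid N" and m: "x \<in> midpoints N" for x
  proof -
    obtain i where i: "i < N" "x = (2 * real i + 1) / (2 * real N)"
      using m unfolding midpoints_def by auto
    then have "x \<in> grid N \<inter> {real i / real N<..<(real i + 1) / real N}"
      using g midpoint_in_cell[OF i(1)] by simp
    then show False
      by (simp add: grid_cell_disjoint[OF i(1)])
  qed
  then show ?thesis by auto
qed

lemma grid_double:
  assumes "N \<ge> 1"
  shows "grid (2 * N) = grid N \<union> midpoints N"
proof (intro equalityI subsetI)
  fix x assume "x \<in> grid (2 * N)"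
  then obtain i where i: "x = real i / real (2 * N)" "1 \<le> i" "i < 2 * N"
    unfolding grid_def by auto
  show "x \<in> grid N \<union> midpoints N"
  proof (cases "even i")
    case True
    then obtain j where "i = 2 * j" by (elim evenE)
    then have "x = real j / real N" "1 \<le> j" "j < N"
      using i by auto
    then show ?thesis
      unfolding grid_def by blast
  next
    case False
    then obtain j where "i = 2 * j + 1" by (elim oddE)
    then have "x = (2 * real j + 1) / (2 * real N)" "j < N"
      using i by auto
    then show ?thesis
      unfolding midpoints_def by blast
  qed
next
  fix x assume "x \<in> grid N \<union> midpoints N"
  then show "x \<in> grid (2 * N)"
  proof
    assume "x \<in> grid N"
    then obtain i where "x = real i / real N" "1 \<le> i" "i < N"
      unfolding grid_def by auto
    then have "x = real (2 * i) / real (2 * N)" "1 \<le> 2 * i" "2 * i < 2 * N"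
      by auto
    then show ?thesis
      unfolding grid_def by blast
  next
    assume "x \<in> midpoints N"
    then obtain i where "x = (2 * real i + 1) / (2 * real N)" "i < N"
      unfolding midpoints_def by auto
    then have "x = real (2 * i + 1) / real (2 * N)" "1 \<le> 2 * i + 1" "2 * i + 1 < 2 * N"
      by auto
    then show ?thesis
      unfolding grid_def by blast
  qed
qed

text \<open>Uncut cells serve twice: they carry the largest residual values, and they are the gaps
  into which further midpoints are inserted.\<close>

lemma grid_cell_gap:
  assumes i: "i < N" and S: "S \<subseteq> midpoints N" "(2 * real i + 1) / (2 * real N) \<notin> S"
  shows "gap (grid N \<union> S) (real i / real N) ((real i + 1) / real N)"
proof -
  have "real i / real N \<in> insert 0 (grid N)"
    using i unfolding grid_def by (cases "i = 0") auto
  moreover have "(real i + 1) / real N \<in> insert 1 (grid N)"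
  proof (cases "i + 1 = N")
    case True
    then have "real N = real i + 1" by auto
    then show ?thesis using i by simp
  next
    case False
    then have "real (i + 1) / real N \<in> grid N"
      using i unfolding grid_def by (intro CollectI exI[of _ "i + 1"]) simp
    then show ?thesis by (simp add: add.commute)
  qed
  moreover have "S \<inter> {real i / real N<..<(real i + 1) / real N} = {}"
    using midpoints_cell[OF i] S by auto
  ultimately show ?thesis
    using grid_cell_disjoint[OF i] i unfolding gap_def by (auto simp: divide_strict_right_mono)
qed

lemma gap_in_grid_cell:
  assumes N: "N \<ge> 1" and X: "X \<subseteq> \<Omega>" "grid N \<subseteq> X" and ab: "gap X a b"
  obtains j where "j < N" "real j / real N \<le> a" "b \<le> (real j + 1) / real N"
proof -
  have bd: "0 \<le> a" "a < b" "b \<le> 1"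
    using gap_bounds[OF X(1) ab] by auto
  have Np: "0 < real N"
    using N by simp
  \<comment> \<open>The index of the cell containing \<open>a\<close>. Its right end either is a
    grid point and stops the gap, or is 1.\<close>
  define j where "j = nat \<lfloor>a * real N\<rfloor>"
  have "0 \<le> a * real N"
    using bd Np by simp
  then have j: "real j \<le> a * real N" "a * real N < real j + 1"
    unfolding j_def by linarith+
  have "a * real N < 1 * real N"
    using bd Np by (intro mult_strict_right_mono) auto
  then have jN: "j < N"
    using j(1) by simp
  have "b \<le> (real j + 1) / real N"
  proof (rule ccontr)
    assume "\<not> ?thesis"
    then have less: "(real j + 1) / real N < b" by simp
    then have "(real j + 1) / real N < 1"
      using bd by simp
    then have "real j + 1 < real N"
      using Np by (simp add: field_simps)
    then have "real (j + 1) / real N \<in> grid N"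
      unfolding grid_def by (intro CollectI exI[of _ "j + 1"]) simp
    moreover have "a < real (j + 1) / real N"
      using j(2) Np by (simp add: field_simps)
    ultimately have "real (j + 1) / real N \<in> X \<inter> {a<..<b}"
      using less X by (auto simp: add.commute)
    then show False
      using ab unfolding gap_def by blast
  qed
  then show ?thesis
    using that[OF jN] j(1) Np by (simp add: field_simps)
qed

text \<open>Each gap lies inside a cell and so has length at most 1/N. Attaining the bound requires
  a gap that fills its cell, with \<open>y\<close> in the middle.\<close>

lemma residual_grid_le:
  assumes N: "N \<ge> 1" and X: "finite X" "X \<subseteq> \<Omega>" "grid N \<subseteq> X" and y: "y \<in> \<Omega>"
  shows "0 \<le> residual bridge_kernel X parabola y"
    and "residual bridge_kernel X parabola y \<le> 1 / (4 * (real N)\<^sup>2)"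
    and "residual bridge_kernel X parabola y = 1 / (4 * (real N)\<^sup>2) \<Longrightarrow> y \<in> midpoints N - X"
proof -
  obtain a b where g: "gap X a b" "a \<le> y" "y < b"
    by (rule gap_exists[OF X(1,2) y])
  have r: "residual bridge_kernel X parabola y = (y - a) * (b - y)"
    by (rule residual_on_gap[OF X(1,2) g(1,2)]) (use g in simp)
  then show "0 \<le> residual bridge_kernel X parabola y"
    using g by simp
  obtain j where j: "j < N" "real j / real N \<le> a" "b \<le> (real j + 1) / real N"
    by (rule gap_in_grid_cell[OF N X(2,3) g(1)])
  have len: "b - a \<le> 1 / real N"
    using j by (simp add: add_divide_distrib)
  have sq: "((b - a) / 2)\<^sup>2 \<le> 1 / (4 * (real N)\<^sup>2)"
  proof -
    have "((b - a) / 2)\<^sup>2 \<le> (1 / real N / 2)\<^sup>2"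
      using len g by (intro power_mono) auto
    then show ?thesis
      by (simp add: power_divide)
  qed
  then show "residual bridge_kernel X parabola y \<le> 1 / (4 * (real N)\<^sup>2)"
    unfolding r parabola_between using zero_le_power2[of "y - (a + b) / 2"] by linarith
  assume "residual bridge_kernel X parabola y = 1 / (4 * (real N)\<^sup>2)"
  \<comment> \<open>The first square is already at most the right side, so the subtracted square
    must be zero and the gap must have full length.\<close>
  then have eq: "((b - a) / 2)\<^sup>2 - (y - (a + b) / 2)\<^sup>2 = 1 / (4 * (real N)\<^sup>2)"
    unfolding r parabola_between .
  then have "(y - (a + b) / 2)\<^sup>2 = 0"
    using sq zero_le_power2[of "y - (a + b) / 2"] by linarith
  then have mid: "y = (a + b) / 2"
    by simp
  have "((b - a) / 2)\<^sup>2 = (1 / real N / 2)\<^sup>2"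
    using eq mid by (simp add: power_divide)
  then have "(b - a) / 2 = 1 / real N / 2"
    by (rule power2_eq_imp_eq) (use g N in auto)
  then have "b = (real j + 1) / real N" "a = real j / real N"
    using j(2,3) by (simp_all add: add_divide_distrib)
  then have "y = (2 * real j + 1) / (2 * real N)"
    unfolding mid using N by (simp add: field_simps)
  then have "y \<in> midpoints N"
    using j(1) unfolding midpoints_def by blast
  moreover have "y \<notin> X"
  proof
    assume "y \<in> X"
    moreover have "y \<in> {a<..<b}"
      using mid g by auto
    ultimately show False
      using g(1) unfolding gap_def by blast
  qed
  ultimately show "y \<in> midpoints N - X" by simp
qed

section \<open>Grids with some cells bisected\<close>

context
  fixes N :: nat and S :: "real set"
  assumes N: "N \<ge> 1" and S: "S \<subseteq> midpoints N"
begin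

lemma refined_grid: "finite (grid N \<union> S)" "grid N \<union> S \<subseteq> \<Omega>"
  using finite_subset[OF S finite_midpoints] finite_grid[of N] grid_subset[of N]
    subset_trans[OF S midpoints_subset] by (simp, blast)

lemma residual_at_midpoint:
  assumes "m \<in> midpoints N - S"
  shows "residual bridge_kernel (grid N \<union> S) parabola m = 1 / (4 * (real N)\<^sup>2)"
proof -
  obtain i where i: "i < N" "m = (2 * real i + 1) / (2 * real N)"
    using assms unfolding midpoints_def by auto
  have "gap (grid N \<union> S) (real i / real N) ((real i + 1) / real N)"
    by (rule grid_cell_gap[OF i(1) S]) (use assms i in simp)
  from residual_on_gap[OF refined_grid this, of m]
  have "residual bridge_kernel (grid N \<union> S) parabola m
      = (m - real i / real N) * ((real i + 1) / real N - m)"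
    using midpoint_in_cell[OF i(1)] i(2) by simp
  moreover have "m - real i / real N = 1 / (2 * real N)" "(real i + 1) / real N - m = 1 / (2 * real N)"
    using i by (simp_all add: field_simps)
  ultimately show ?thesis
    by (simp add: power2_eq_square)
qed

lemma midpoints_not_in_refined_grid: "m \<in> midpoints N - S \<Longrightarrow> m \<in> \<Omega> - (grid N \<union> S)"
  using grid_midpoints_disjoint[of N] midpoints_subset[of N] by blast

lemma Linf_norm_refined_grid:
  assumes "S \<noteq> midpoints N"
  shows "Linf_norm (residual bridge_kernel (grid N \<union> S) parabola) = 1 / (4 * (real N)\<^sup>2)"
proof -
  obtain m where m: "m \<in> midpoints N - S"
    using assms S by blast
  show ?thesis
  proof (rule Linf_norm_eqI[OF residual_continuous[OF refined_grid]])
    show "m \<in> \<Omega>"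
      using midpoints_not_in_refined_grid[OF m] by blast
    show "\<bar>residual bridge_kernel (grid N \<union> S) parabola m\<bar> = 1 / (4 * (real N)\<^sup>2)"
      by (simp add: residual_at_midpoint[OF m])
    fix y assume "y \<in> \<Omega>"
    from residual_grid_le(1,2)[OF N refined_grid _ this]
    show "\<bar>residual bridge_kernel (grid N \<union> S) parabola y\<bar> \<le> 1 / (4 * (real N)\<^sup>2)"
      by simp
  qed
qed

text \<open>While a midpoint is still free its residual reaches the upper bound
  \<open>1 / (4 * N^2)\<close>, so a maximizer must reach it too, and only free midpoints
  do.\<close>

lemma greedy_step_iff:
  assumes "S \<noteq> midpoints N"
  shows "(p \<in> \<Omega> - (grid N \<union> S) \<and> (\<forall>y \<in> \<Omega> - (grid N \<union> S).
      \<bar>residual bridge_kernel (grid N \<union> S) parabola y\<bar> \<le> \<bar>residual bridge_kernel (grid N \<union> S) parabola p\<bar>))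
    \<longleftrightarrow> p \<in> midpoints N - S" (is "?L \<longleftrightarrow> ?R")
proof
  note le = residual_grid_le[OF N refined_grid Un_upper1]
  {
    assume L: ?L
    then have p: "p \<in> \<Omega>" by blast
    obtain m where m: "m \<in> midpoints N - S"
      using assms S by blast
    have "\<bar>residual bridge_kernel (grid N \<union> S) parabola m\<bar> \<le> \<bar>residual bridge_kernel (grid N \<union> S) parabola p\<bar>"
      using L midpoints_not_in_refined_grid[OF m] by blast
    then have "residual bridge_kernel (grid N \<union> S) parabola p = 1 / (4 * (real N)\<^sup>2)"
      using le(1,2)[OF p] residual_at_midpoint[OF m] by simp
    from le(3)[OF p this] show ?R
      by blast
  next
    assume R: ?R
    have "\<bar>residual bridge_kernel (grid N \<union> S) parabola y\<bar> \<le> \<bar>residual bridge_kernel (grid N \<union> S) parabola p\<bar>"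
      if "y \<in> \<Omega>" for y
      using le(1,2)[OF that] residual_at_midpoint[OF R] by simp
    then show ?L
      using midpoints_not_in_refined_grid[OF R] by blast
  }
qed

end

text \<open>Every midpoint enters an uncut cell of its own, so each insertion costs
  \<open>(1/N) * (1/(2*N))^2\<close> regardless of the order.\<close>

lemma energy_refined_grid:
  assumes N: "N \<ge> 1" and "S \<subseteq> midpoints N"
  shows "energy (grid N \<union> S) = energy (grid N) - real (card S) / (4 * real N ^ 3)"
proof -
  have "finite S"
    by (rule finite_subset[OF assms(2) finite_midpoints])
  then show ?thesis
    using assms(2)
  proof (induction S rule: finite_induct)
    case empty
    then show ?case by simp
  next
    case (insert z S)
    obtain i where i: "i < N" "z = (2 * real i + 1) / (2 * real N)"
      using insert.prems unfolding midpoints_def by auto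
    have S: "S \<subseteq> midpoints N" "(2 * real i + 1) / (2 * real N) \<notin> S"
      using insert.prems insert.hyps i by auto
    have "energy (insert z (grid N \<union> S)) = energy (grid N \<union> S)
        - ((real i + 1) / real N - real i / real N) * (z - real i / real N) * ((real i + 1) / real N - z)"
      by (rule energy_insert[OF refined_grid[OF N S(1)] grid_cell_gap[OF i(1) S]])
        (use midpoint_in_cell[OF i(1)] i(2) in auto)
    moreover have "(real i + 1) / real N - real i / real N = 1 / real N"
      "z - real i / real N = 1 / (2 * real N)" "(real i + 1) / real N - z = 1 / (2 * real N)"
      using i by (simp_all add: field_simps)
    ultimately have "energy (insert z (grid N \<union> S)) = energy (grid N \<union> S) - 1 / (4 * real N ^ 3)"
      by (simp add: power3_eq_cube mult.assoc)
    then show ?case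
      using insert.IH[OF S(1)] insert.hyps by (simp add: add_divide_distrib)
  qed
qed

text \<open>The grid is built from left to right, each point being inserted into the last gap, which
  reaches up to 1.\<close>

lemma energy_grid:
  assumes "N \<ge> 1"
  shows "energy (grid N) = 1 / (3 * (real N)\<^sup>2)"
proof -
  define h where "h = 1 / real N"
  define P where "P i = (\<lambda>j. real j * h) ` {1..i}" for i
  have h: "0 < h" "real N * h = 1"
    using assms by (simp_all add: h_def)
  have Nh: "real j * h < 1" if "j < N" for j
    using that h mult_strict_right_mono[of "real j" "real N" h] by simp
  have P: "finite (P i)" "P i \<subseteq> \<Omega>" if "i < N" for i
    using that h Nh by (auto simp: P_def)
  \<comment> \<open>A gap of length d contributes d^3/3. There are \<open>i\<close> gaps of length
    \<open>h\<close> and one of length \<open>1 - i * h\<close>.\<close>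
  have "energy (P i) = real i * h ^ 3 / 3 + (1 - real i * h) ^ 3 / 3" if "i < N" for i
    using that
  proof (induction i)
    case 0
    then show ?case by (simp add: P_def energy_empty)
  next
    case (Suc i)
    have g: "gap (P i) (real i * h) 1"
    proof -
      have "real i * h \<in> insert 0 (P i)"
        by (cases "i = 0") (auto simp: P_def)
      moreover have "P i \<inter> {real i * h<..<1} = {}"
        using h by (auto simp: P_def)
      ultimately show ?thesis
        using Nh[of i] Suc.prems unfolding gap_def by simp
    qed
    have "P (Suc i) = insert (real (Suc i) * h) (P i)"
      by (simp add: P_def atLeastAtMostSuc_conv)
    then have "energy (P (Suc i)) = energy (P i)
        - (1 - real i * h) * (real (Suc i) * h - real i * h) * (1 - real (Suc i) * h)"
      using energy_insert[OF P g, of "real (Suc i) * h"] Suc.prems h Nh[OF Suc.prems] by simp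
    then show ?case
      using Suc by (simp add: field_simps power3_eq_cube)
  qed
  from this[of "N - 1"] have "energy (P (N - 1)) = real (N - 1) * h ^ 3 / 3 + (1 - real (N - 1) * h) ^ 3 / 3"
    using assms by simp
  also have "real (N - 1) * h = 1 - h"
    using assms h by (simp add: of_nat_diff left_diff_distrib)
  also have "real (N - 1) * h ^ 3 / 3 + (1 - (1 - h)) ^ 3 / 3 = (real N * h) * h\<^sup>2 / 3"
    using assms by (simp add: of_nat_diff field_simps power3_eq_cube power2_eq_square)
  also have "\<dots> = 1 / (3 * (real N)\<^sup>2)"
    using h by (simp add: h_def power_divide)
  also have "P (N - 1) = grid N"
    unfolding P_def grid_image h_def using assms by (intro image_cong) auto
  finally show ?thesis .
qed

section \<open>Optimality of equally spaced points\<close>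

text \<open>Walking from the left, the \<open>i\<close>-th point is at most \<open>i\<close> gap lengths from \<open>0\<close>; walking from
  the right, it is at most \<open>n + 1 - i\<close> gap lengths from \<open>1\<close>. Both bounds must then be equalities.\<close>

lemma grid_of_short_gaps:
  assumes X: "finite X" "X \<subseteq> \<Omega>" and N: "N = card X + 1"
    and short: "\<And>a b. gap X a b \<Longrightarrow> b - a \<le> 1 / real N"
  shows "X = grid N"
proof -
  \<comment> \<open>Without \<open>x\<close> the point lies inside a gap of the remaining set;
    putting it back splits this gap into its two neighbours.\<close>
  have adjacent: "\<exists>a b. gap X a x \<and> gap X x b" if x: "x \<in> X" for x
  proof -
    obtain a b where ab: "gap (X - {x}) a b" "a < x" "x < b"
      using gap_neighbours[of "X - {x}" x] X x by blast
    then have g: "a \<in> insert 0 X" "b \<in> insert 1 X" "a < x" "x < b"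
      unfolding gap_def by blast+
    have empty: False if "y \<in> X" "y \<noteq> x" "a < y" "y < b" for y
    proof -
      have "y \<in> (X - {x}) \<inter> {a<..<b}"
        using that by simp
      then show False
        using ab(1) unfolding gap_def by simp
    qed
    have "X \<inter> {a<..<x} = {}" "X \<inter> {x<..<b} = {}"
      using empty g(3,4) by (force simp: disjoint_iff)+
    then have "gap X a x" "gap X x b"
      using g x unfolding gap_def by simp_all
    then show ?thesis by blast
  qed
  \<comment> \<open>Induction on the number of points up to \<open>x\<close>. If the left neighbour
    is 0 its bound is trivial, and the count still grows because \<open>x\<close> is counted
    itself.\<close>
  have left: "x \<le> real (card {z \<in> X. z \<le> x}) / real N" if "x \<in> X" for x
    using that
  proof (induction "card {z \<in> X. z \<le> x}" arbitrary: x rule: less_induct)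
    case less
    obtain a where a: "gap X a x"
      using adjacent[OF less.prems] by blast
    have ax: "a < x" "x \<le> a + 1 / real N"
      using short[OF a] a unfolding gap_def by auto
    have step: "card {z \<in> X. z \<le> a} + 1 \<le> card {z \<in> X. z \<le> x}"
    proof -
      have "{z \<in> X. z \<le> a} \<subset> {z \<in> X. z \<le> x}"
      proof (rule psubsetI)
        show "{z \<in> X. z \<le> a} \<subseteq> {z \<in> X. z \<le> x}"
          using ax(1) by auto
        have "x \<in> {z \<in> X. z \<le> x}" "x \<notin> {z \<in> X. z \<le> a}"
          using ax(1) less.prems by simp_all
        then show "{z \<in> X. z \<le> a} \<noteq> {z \<in> X. z \<le> x}"
          by blast
      qed
      then have "card {z \<in> X. z \<le> a} < card {z \<in> X. z \<le> x}"
        using X(1) by (intro psubset_card_mono) auto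
      then show ?thesis by simp
    qed
    have "a \<le> real (card {z \<in> X. z \<le> a}) / real N"
    proof (cases "a \<in> X")
      case True
      then show ?thesis
        using less.hyps[of a] step by simp
    next
      case False
      then show ?thesis
        using a unfolding gap_def by simp
    qed
    then have "x \<le> real (card {z \<in> X. z \<le> a} + 1) / real N"
      using ax(2) by (simp add: add_divide_distrib)
    also have "\<dots> \<le> real (card {z \<in> X. z \<le> x}) / real N"
      by (intro divide_right_mono) (use step in simp_all)
    finally show ?case .
  qed
  have right: "1 - x \<le> real (card {z \<in> X. x \<le> z}) / real N" if "x \<in> X" for x
    using that
  proof (induction "card {z \<in> X. x \<le> z}" arbitrary: x rule: less_induct)
    case less
    obtain b where b: "gap X x b"
      using adjacent[OF less.prems] by blast
    have xb: "x < b" "b \<le> x + 1 / real N"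
      using short[OF b] b unfolding gap_def by auto
    have step: "card {z \<in> X. b \<le> z} + 1 \<le> card {z \<in> X. x \<le> z}"
    proof -
      have "{z \<in> X. b \<le> z} \<subset> {z \<in> X. x \<le> z}"
      proof (rule psubsetI)
        show "{z \<in> X. b \<le> z} \<subseteq> {z \<in> X. x \<le> z}"
          using xb(1) by auto
        have "x \<in> {z \<in> X. x \<le> z}" "x \<notin> {z \<in> X. b \<le> z}"
          using xb(1) less.prems by simp_all
        then show "{z \<in> X. b \<le> z} \<noteq> {z \<in> X. x \<le> z}"
          by blast
      qed
      then have "card {z \<in> X. b \<le> z} < card {z \<in> X. x \<le> z}"
        using X(1) by (intro psubset_card_mono) auto
      then show ?thesis by simp
    qed
    have "1 - b \<le> real (card {z \<in> X. b \<le> z}) / real N"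
    proof (cases "b \<in> X")
      case True
      then show ?thesis
        using less.hyps[of b] step by simp
    next
      case False
      then show ?thesis
        using b unfolding gap_def by simp
    qed
    then have "1 - x \<le> real (card {z \<in> X. b \<le> z} + 1) / real N"
      using xb(2) by (simp add: add_divide_distrib)
    also have "\<dots> \<le> real (card {z \<in> X. x \<le> z}) / real N"
      by (intro divide_right_mono) (use step in simp_all)
    finally show ?case .
  qed
  have "x \<in> grid N" if x: "x \<in> X" for x
  proof -
    let ?L = "{z \<in> X. z \<le> x}" and ?R = "{z \<in> X. x \<le> z}"
    have fin: "finite ?L" "finite ?R"
      using X(1) by auto
    \<comment> \<open>\<open>x\<close> is counted on both sides, so the two counts add up to
      \<open>card X + 1 = N\<close>. The bounds on \<open>x\<close> and \<open>1 - x\<close> then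
      add up to 1, and neither can be strict.\<close>
    have "?L \<union> ?R = X" "?L \<inter> ?R = {x}"
      using x by auto
    then have sum: "card ?L + card ?R = N"
      using card_Un_Int[OF fin] N by simp
    have Np: "0 < real N"
      using N by simp
    have "real (card ?L) / real N + real (card ?R) / real N = 1"
      using sum Np by (simp add: add_divide_distrib[symmetric] flip: of_nat_add)
    then have "x = real (card ?L) / real N"
      using left[OF x] right[OF x] by linarith
    moreover have "card ?L \<ge> 1" "card ?R \<ge> 1"
      using x fin by (auto simp: Suc_le_eq card_gt_0_iff)
    ultimately show ?thesis
      using sum unfolding grid_def by (intro CollectI exI[of _ "card ?L"]) simp
  qed
  then have "X \<subseteq> grid N"
    by blast
  moreover have "card X = card (grid N)"
    unfolding card_grid using N by simp
  ultimately show ?thesis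
    by (rule card_subset_eq[OF finite_grid])
qed

lemma Linf_norm_grid:
  assumes "N \<ge> 1"
  shows "Linf_norm (residual bridge_kernel (grid N) parabola) = 1 / (4 * (real N)\<^sup>2)"
proof -
  have "{} \<noteq> midpoints N"
    using card_midpoints[of N] assms by auto
  from Linf_norm_refined_grid[OF assms _ this] show ?thesis by simp
qed

lemma Linf_norm_not_grid:
  assumes X: "finite X" "X \<subseteq> \<Omega>" and "X \<noteq> grid (card X + 1)"
  shows "Linf_norm (residual bridge_kernel (grid (card X + 1)) parabola)
    < Linf_norm (residual bridge_kernel X parabola)"
proof -
  define N where "N = card X + 1"
  have N: "0 < real N" "N \<ge> 1"
    by (simp_all add: N_def)
  obtain a b where ab: "gap X a b" "Linf_norm (residual bridge_kernel X parabola) = ((b - a) / 2)\<^sup>2"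
    "\<forall>a' b'. gap X a' b' \<longrightarrow> b' - a' \<le> b - a"
    by (rule Linf_norm_residual[OF X])
  have "1 / real N < b - a"
  proof (rule ccontr)
    assume less: "\<not> ?thesis"
    have short: "b' - a' \<le> 1 / real N" if "gap X a' b'" for a' b'
    proof -
      have "b' - a' \<le> b - a"
        using ab(3) that by blast
      then show ?thesis
        using less by linarith
    qed
    have "X = grid N"
      by (rule grid_of_short_gaps[OF X N_def short])
    then show False
      using assms(3) by (simp add: N_def)
  qed
  then have "(1 / real N / 2)\<^sup>2 < ((b - a) / 2)\<^sup>2"
    by (intro power_strict_mono divide_strict_right_mono) (use N in simp_all)
  moreover have "(1 / real N / 2)\<^sup>2 = 1 / (4 * (real N)\<^sup>2)"
    by (simp add: power_divide)
  ultimately show ?thesis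
    unfolding ab(2) N_def[symmetric] Linf_norm_grid[OF N(2)] by simp
qed

theorem equi_points_unique_minimizer:
  "is_arg_min (\<lambda>X. Linf_norm (residual bridge_kernel X parabola))
     (\<lambda>X. X \<subseteq> \<Omega> \<and> finite X \<and> card X = n) X \<longleftrightarrow> X = equi_points n"
proof -
  let ?F = "\<lambda>X. Linf_norm (residual bridge_kernel X parabola)"
  have e: "grid (n + 1) \<subseteq> \<Omega>" "finite (grid (n + 1))" "card (grid (n + 1)) = n"
    using grid_subset finite_grid card_grid[of "n + 1"] by auto
  have min: "?F (grid (n + 1)) < ?F Y" if "Y \<subseteq> \<Omega>" "finite Y" "card Y = n" "Y \<noteq> grid (n + 1)" for Y
    using Linf_norm_not_grid[of Y] that by simp
  show ?thesis
    unfolding is_arg_min_def equi_points_grid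
  proof
    assume X: "X = grid (n + 1)"
    have "\<not> ?F y < ?F X" if "y \<subseteq> \<Omega> \<and> finite y \<and> card y = n" for y
      using min[of y] that X by (cases "y = X") auto
    then show "(X \<subseteq> \<Omega> \<and> finite X \<and> card X = n) \<and> \<not> (\<exists>y. (y \<subseteq> \<Omega> \<and> finite y \<and> card y = n) \<and> ?F y < ?F X)"
      using e X by blast
  next
    assume "(X \<subseteq> \<Omega> \<and> finite X \<and> card X = n) \<and> \<not> (\<exists>y. (y \<subseteq> \<Omega> \<and> finite y \<and> card y = n) \<and> ?F y < ?F X)"
    then show "X = grid (n + 1)"
      using e min[of X] by blast
  qed
qed

section \<open>The greedy algorithm\<close>

text \<open>Block \<open>k\<close> corresponds to level \<open>l = k + 1\<close> and occupies the
  indices from \<open>2^k\<close> to \<open>2^(k+1) - 1\<close>. A bijection onto the midpoints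
  expresses that their order within the block is free.\<close>

definition dyadic_sequence :: "(nat \<Rightarrow> real) \<Rightarrow> bool" where
  "dyadic_sequence x \<longleftrightarrow> (\<forall>k. bij_betw (\<lambda>i. x (2 ^ k + i)) {..<2 ^ k} (midpoints (2 ^ k)))"

lemma all_ge_1_iff: "(\<forall>n::nat. 1 \<le> n \<longrightarrow> P n) \<longleftrightarrow> (\<forall>k. P (Suc k))"
  by (auto simp: Suc_le_eq gr0_conv_Suc)

lemma dyadic_sequence_levels:
  "dyadic_sequence x \<longleftrightarrow> (\<forall>l::nat. l \<ge> 1 \<longrightarrow>
     bij_betw (\<lambda>i. x (2 ^ (l - 1) + i)) {..<2 ^ (l - 1)} {(2 * real i + 1) / 2 ^ l | i. i < 2 ^ (l - 1)})"
  (is "_ \<longleftrightarrow> (\<forall>l. l \<ge> 1 \<longrightarrow> ?P l)")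
proof -
  have "?P (Suc k) \<longleftrightarrow> bij_betw (\<lambda>i. x (2 ^ k + i)) {..<2 ^ k} (midpoints (2 ^ k))" for k
    by (simp add: midpoints_def)
  then show ?thesis
    unfolding dyadic_sequence_def all_ge_1_iff[of ?P] by (simp only:)
qed

lemma dyadic_index:
  assumes "n \<ge> 1"
  obtains k i :: nat where "n = 2 ^ k + i" "i < 2 ^ k"
proof -
  obtain k where k: "2 ^ k \<le> n" "n < 2 ^ (k + 1)"
    using ex_power_ivl1[of 2 n] assms by auto
  show ?thesis
    by (rule that[of k "n - 2 ^ k"]) (use k in auto)
qed

lemma image_dyadic_block:
  fixes x :: "nat \<Rightarrow> 'a"
  shows "x ` {1..<2 ^ k + i} = x ` {1..<2 ^ k} \<union> (\<lambda>j. x (2 ^ k + j)) ` {..<i :: nat}"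
proof -
  have "{1..<2 ^ k + i} = {1..<2 ^ k} \<union> (\<lambda>j. 2 ^ k + j) ` {..<i}"
  proof (intro equalityI subsetI)
    fix n assume n: "n \<in> {1..<2 ^ k + i}"
    show "n \<in> {1..<2 ^ k} \<union> (\<lambda>j. 2 ^ k + j) ` {..<i}"
    proof (cases "n < 2 ^ k")
      case False
      then show ?thesis
        using n by (intro UnI2 image_eqI[of _ _ "n - 2 ^ k"]) auto
    qed (use n in simp)
  next
    fix n :: nat assume "n \<in> {1..<2 ^ k} \<union> (\<lambda>j. 2 ^ k + j) ` {..<i}"
    moreover have "(1::nat) \<le> 2 ^ k" by simp
    ultimately show "n \<in> {1..<2 ^ k + i}"
      by (elim UnE imageE) (simp_all add: trans_le_add1)
  qed
  then show ?thesis
    by (simp only: image_Un image_image)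
qed

text \<open>Only blocks before \<open>k\<close> are assumed, so the lemma also applies inside the
  induction that proves a greedy sequence to be dyadic.\<close>

lemma image_dyadic_prefix:
  fixes x :: "nat \<Rightarrow> real"
  assumes "\<And>j. j < k \<Longrightarrow> bij_betw (\<lambda>i. x (2 ^ j + i)) {..<2 ^ j} (midpoints (2 ^ j))"
  shows "x ` {1..<2 ^ k} = grid (2 ^ k)"
  using assms
proof (induction k)
  case 0
  then show ?case by (simp add: grid_def)
next
  case (Suc k)
  have "x ` {1..<2 ^ Suc k} = x ` {1..<2 ^ k} \<union> (\<lambda>j. x (2 ^ k + j)) ` {..<2 ^ k}"
    using image_dyadic_block[of x k "2 ^ k"] by (simp add: mult_2)
  also have "(\<lambda>j. x (2 ^ k + j)) ` {..<2 ^ k} = midpoints (2 ^ k)"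
    using Suc.prems[of k] by (simp add: bij_betw_def)
  also have "x ` {1..<2 ^ k} = grid (2 ^ k)"
    using Suc by simp
  finally show ?case
    using grid_double[of "2 ^ k"] by simp
qed

text \<open>The condition is re-indexed by the point being chosen; half-open index ranges split
  cleanly at powers of two.\<close>

lemma f_greedy_iff_steps:
  "f_greedy \<Omega> bridge_kernel parabola x \<longleftrightarrow> (\<forall>n\<ge>1. x n \<in> \<Omega> - x ` {1..<n} \<and>
     (\<forall>y \<in> \<Omega> - x ` {1..<n}. \<bar>residual bridge_kernel (x ` {1..<n}) parabola y\<bar>
       \<le> \<bar>residual bridge_kernel (x ` {1..<n}) parabola (x n)\<bar>))"
  (is "_ \<longleftrightarrow> (\<forall>n\<ge>1. ?P n)")
proof -
  have "f_greedy \<Omega> bridge_kernel parabola x \<longleftrightarrow> (\<forall>n. ?P (Suc n))"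
    by (simp only: f_greedy_def atLeastLessThanSuc_atLeastAtMost)
  also have "\<dots> \<longleftrightarrow> (\<forall>n\<ge>1. ?P n)"
    by (rule all_ge_1_iff[symmetric])
  finally show ?thesis .
qed

lemma greedy_step_dyadic:
  fixes x :: "nat \<Rightarrow> real"
  assumes pre: "x ` {1..<2 ^ k} = grid (2 ^ k)" and i: "i < 2 ^ k"
    and S: "(\<lambda>j. x (2 ^ k + j)) ` {..<i} \<subseteq> midpoints (2 ^ k)"
  defines "n \<equiv> 2 ^ k + i"
  shows "(x n \<in> \<Omega> - x ` {1..<n} \<and> (\<forall>y \<in> \<Omega> - x ` {1..<n}.
      \<bar>residual bridge_kernel (x ` {1..<n}) parabola y\<bar> \<le> \<bar>residual bridge_kernel (x ` {1..<n}) parabola (x n)\<bar>))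
    \<longleftrightarrow> x n \<in> midpoints (2 ^ k) - (\<lambda>j. x (2 ^ k + j)) ` {..<i}"
proof -
  have "card ((\<lambda>j. x (2 ^ k + j)) ` {..<i}) < 2 ^ k"
    using card_image_le[of "{..<i}" "\<lambda>j. x (2 ^ k + j)"] i by simp
  then have ne: "(\<lambda>j. x (2 ^ k + j)) ` {..<i} \<noteq> midpoints (2 ^ k)"
    using card_midpoints[of "2 ^ k"] by auto
  have N: "(1::nat) \<le> 2 ^ k"
    by simp
  show ?thesis
    unfolding n_def image_dyadic_block pre by (rule greedy_step_iff[OF N S ne])
qed

theorem f_greedy_iff_dyadic: "f_greedy \<Omega> bridge_kernel parabola x \<longleftrightarrow> dyadic_sequence x"
proof
  assume D: "dyadic_sequence x"
  show "f_greedy \<Omega> bridge_kernel parabola x"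
    unfolding f_greedy_iff_steps
  proof (intro allI impI)
    fix n :: nat assume "n \<ge> 1"
    then obtain k i where n: "n = 2 ^ k + i" and i: "i < 2 ^ k"
      by (rule dyadic_index)
    have pre: "x ` {1..<2 ^ k} = grid (2 ^ k)"
      by (rule image_dyadic_prefix) (use D in \<open>simp add: dyadic_sequence_def\<close>)
    have inj: "inj_on (\<lambda>j. x (2 ^ k + j)) {..<2 ^ k}"
      and im: "(\<lambda>j. x (2 ^ k + j)) ` {..<2 ^ k} = midpoints (2 ^ k)"
      using D unfolding dyadic_sequence_def bij_betw_def by auto
    have S: "(\<lambda>j. x (2 ^ k + j)) ` {..<i} \<subseteq> midpoints (2 ^ k)"
      unfolding im[symmetric] by (rule image_mono) (use i in auto)
    have "x (2 ^ k + i) \<in> midpoints (2 ^ k)"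
      unfolding im[symmetric] using i by blast
    moreover have "x (2 ^ k + i) \<notin> (\<lambda>j. x (2 ^ k + j)) ` {..<i}"
    proof
      assume "x (2 ^ k + i) \<in> (\<lambda>j. x (2 ^ k + j)) ` {..<i}"
      then obtain j where "j < i" "x (2 ^ k + i) = x (2 ^ k + j)"
        by auto
      then show False
        using inj_onD[OF inj, of i j] i by simp
    qed
    ultimately have "x (2 ^ k + i) \<in> midpoints (2 ^ k) - (\<lambda>j. x (2 ^ k + j)) ` {..<i}"
      by blast
    from greedy_step_dyadic[OF pre i S, THEN iffD2, OF this]
    show "x n \<in> \<Omega> - x ` {1..<n} \<and> (\<forall>y \<in> \<Omega> - x ` {1..<n}.
        \<bar>residual bridge_kernel (x ` {1..<n}) parabola y\<bar> \<le> \<bar>residual bridge_kernel (x ` {1..<n}) parabola (x n)\<bar>)"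
      unfolding n .
  qed
next
  assume "f_greedy \<Omega> bridge_kernel parabola x"
  note G = this[unfolded f_greedy_iff_steps, THEN spec, THEN mp]
  show "dyadic_sequence x"
    unfolding dyadic_sequence_def
  proof
    fix k
    show "bij_betw (\<lambda>i. x (2 ^ k + i)) {..<2 ^ k} (midpoints (2 ^ k))"
    proof (induction k rule: less_induct)
      case (less k)
      define y where "y i = x (2 ^ k + i)" for i
      have pre: "x ` {1..<2 ^ k} = grid (2 ^ k)"
        by (rule image_dyadic_prefix[OF less.IH])
      have step: "y i \<in> midpoints (2 ^ k) - y ` {..<i}" if "i < 2 ^ k" "y ` {..<i} \<subseteq> midpoints (2 ^ k)" for i
      proof -
        have "1 \<le> 2 ^ k + i"
          by (simp add: trans_le_add1)
        from greedy_step_dyadic[OF pre that(1) that(2)[unfolded y_def], THEN iffD1, OF G[OF this]]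
        show ?thesis
          unfolding y_def .
      qed
      \<comment> \<open>Injectivity and range go together: the next choice is known to be a fresh
        midpoint only if all earlier ones were midpoints.\<close>
      have "inj_on y {..<i} \<and> y ` {..<i} \<subseteq> midpoints (2 ^ k)" if "i \<le> 2 ^ k" for i
        using that
      proof (induction i)
        case (Suc i)
        then have IH: "inj_on y {..<i}" "y ` {..<i} \<subseteq> midpoints (2 ^ k)"
          by simp_all
        have "y i \<in> midpoints (2 ^ k) - y ` {..<i}"
          by (rule step) (use Suc.prems IH in simp_all)
        then show ?case
          using IH by (simp add: lessThan_Suc)
      qed simp
      from this[OF order_refl] have inj: "inj_on y {..<2 ^ k}" and sub: "y ` {..<2 ^ k} \<subseteq> midpoints (2 ^ k)"
        by simp_all
      have "y ` {..<2 ^ k} = midpoints (2 ^ k)"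
        by (rule card_subset_eq[OF finite_midpoints sub]) (simp add: card_image[OF inj] card_midpoints)
      with inj show ?case
        unfolding bij_betw_def y_def by simp
    qed
  qed
qed

lemma dyadic_prefix_refined_grid:
  assumes D: "dyadic_sequence x" and i: "i < 2 ^ k"
  obtains S where "S \<subseteq> midpoints (2 ^ k)" "card S = i" "x ` {1..<2 ^ k + i} = grid (2 ^ k) \<union> S"
proof
  define S where "S = (\<lambda>j. x (2 ^ k + j)) ` {..<i}"
  have inj: "inj_on (\<lambda>j. x (2 ^ k + j)) {..<2 ^ k}"
    and im: "(\<lambda>j. x (2 ^ k + j)) ` {..<2 ^ k} = midpoints (2 ^ k)"
    using D unfolding dyadic_sequence_def bij_betw_def by auto
  have sub: "{..<i} \<subseteq> {..<2 ^ k}"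
    using i by auto
  show "S \<subseteq> midpoints (2 ^ k)"
    unfolding S_def im[symmetric] by (rule image_mono[OF sub])
  show "card S = i"
    unfolding S_def using card_image[OF inj_on_subset[OF inj sub]] by simp
  have "x ` {1..<2 ^ k} = grid (2 ^ k)"
    by (rule image_dyadic_prefix) (use D in \<open>simp add: dyadic_sequence_def\<close>)
  then show "x ` {1..<2 ^ k + i} = grid (2 ^ k) \<union> S"
    by (simp only: image_dyadic_block S_def)
qed

section \<open>Norms along the greedy sequence and comparison of their ratios\<close>

lemma greedy_residual_norms:
  assumes D: "dyadic_sequence x" and i: "i < 2 ^ k"
  shows "Linf_norm (residual bridge_kernel (x ` {1..<2 ^ k + i}) parabola) = 1 / (4 * (2 ^ k)\<^sup>2)"
    and "H01_norm (residual bridge_kernel (x ` {1..<2 ^ k + i}) parabola) =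
      sqrt ((4 * 2 ^ k - 3 * real i) / (12 * (2 ^ k) ^ 3))"
proof -
  obtain S where S: "S \<subseteq> midpoints (2 ^ k)" "card S = i" "x ` {1..<2 ^ k + i} = grid (2 ^ k) \<union> S"
    by (rule dyadic_prefix_refined_grid[OF D i])
  have "S \<noteq> midpoints (2 ^ k)"
    using S(2) card_midpoints[of "2 ^ k"] i by auto
  then show "Linf_norm (residual bridge_kernel (x ` {1..<2 ^ k + i}) parabola) = 1 / (4 * (2 ^ k)\<^sup>2)"
    unfolding S(3) using Linf_norm_refined_grid[of "2 ^ k" S] S(1) by simp
  have "energy (grid (2 ^ k) \<union> S) = 1 / (3 * (2 ^ k)\<^sup>2) - real i / (4 * (2 ^ k) ^ 3)"
    using energy_refined_grid[of "2 ^ k" S] energy_grid[of "2 ^ k"] S by simp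
  also have "\<dots> = (4 * 2 ^ k - 3 * real i) / (12 * (2 ^ k) ^ 3)"
    by (simp add: field_simps power2_eq_square power3_eq_cube)
  finally show "H01_norm (residual bridge_kernel (x ` {1..<2 ^ k + i}) parabola) =
      sqrt ((4 * 2 ^ k - 3 * real i) / (12 * (2 ^ k) ^ 3))"
    unfolding S(3) by (simp add: H01_norm_def energy_def)
qed

lemma equi_residual_norms:
  "Linf_norm (equi_residual n) = 1 / (4 * (real n + 1)\<^sup>2)"
  "H01_norm (equi_residual n) = 1 / (sqrt 3 * (real n + 1))"
proof -
  show "Linf_norm (equi_residual n) = 1 / (4 * (real n + 1)\<^sup>2)"
    using Linf_norm_grid[of "n + 1"] by (simp add: equi_points_grid add.commute)
  have "energy (grid (n + 1)) = 1 / (3 * (real n + 1)\<^sup>2)"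
    using energy_grid[of "n + 1"] by (simp add: add.commute)
  then show "H01_norm (equi_residual n) = 1 / (sqrt 3 * (real n + 1))"
    by (simp add: H01_norm_def energy_def equi_points_grid real_sqrt_divide real_sqrt_mult)
qed

text \<open>\<open>N\<close> stands for the level size \<open>2^k\<close>, \<open>t\<close> for the
  number of midpoints already taken, and \<open>N + t\<close> for the index of the next point.
  Squaring reduces both bounds to quadratic inequalities in \<open>N\<close> and
  \<open>t\<close>.\<close>

lemma norm_ratio_bounds:
  fixes N t :: real
  assumes N: "N > 0" and t: "0 \<le> t" "t \<le> N"
  defines "L \<equiv> 1 / (4 * N\<^sup>2)" and "H \<equiv> sqrt ((4 * N - 3 * t) / (12 * N ^ 3))"
  shows "sqrt 3 / (4 * sqrt 2) / (N + t) \<le> L / H" "L / H \<le> sqrt 3 / (N + t)"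
proof -
  define E where "E = (4 * N - 3 * t) / (12 * N ^ 3)"
  have E: "0 < E"
    using N t by (simp add: E_def)
  have H: "0 < H" "H\<^sup>2 = E"
    using E by (simp_all add: H_def E_def)
  have ratio: "(L / H)\<^sup>2 = 3 / (4 * N * (4 * N - 3 * t))"
    unfolding power_divide H(2) using N t by (simp add: L_def E_def power2_eq_square power3_eq_cube field_simps)
  have pos: "0 < 4 * N * (4 * N - 3 * t)"
    using N t by simp
  have Nt: "0 < N + t"
    using N t by simp
  \<comment> \<open>The difference has nonnegative coefficients only; even at \<open>t = 0\<close> a
    factor 2 is left over.\<close>
  have low: "4 * N * (4 * N - 3 * t) \<le> 32 * (N + t)\<^sup>2"
  proof -
    have "32 * (N + t)\<^sup>2 - 4 * N * (4 * N - 3 * t) = 16 * N\<^sup>2 + 76 * (N * t) + 32 * t\<^sup>2"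
      by (simp add: power2_eq_square algebra_simps)
    moreover have "0 \<le> 16 * N\<^sup>2 + 76 * (N * t) + 32 * t\<^sup>2"
      using N t by simp
    ultimately show ?thesis by linarith
  qed
  \<comment> \<open>The factor \<open>N - t\<close> shows that equality would occur at a completed
    level, \<open>t = N\<close>; this is the origin of the constant 4.\<close>
  have high: "(N + t)\<^sup>2 \<le> 4 * N * (4 * N - 3 * t)"
  proof -
    have "4 * N * (4 * N - 3 * t) - (N + t)\<^sup>2 = (15 * N + t) * (N - t)"
      by (simp add: power2_eq_square algebra_simps)
    moreover have "0 \<le> (15 * N + t) * (N - t)"
      using N t by simp
    ultimately show ?thesis by linarith
  qed
  have "(sqrt 3 / (4 * sqrt 2) / (N + t))\<^sup>2 = 3 / (32 * (N + t)\<^sup>2)"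
    by (simp add: power_divide power_mult_distrib)
  also have "\<dots> \<le> (L / H)\<^sup>2"
    unfolding ratio by (rule divide_left_mono[OF low]) (use pos Nt in simp_all)
  finally show "sqrt 3 / (4 * sqrt 2) / (N + t) \<le> L / H"
    by (rule power2_le_imp_le) (use H N in \<open>simp add: L_def\<close>)
  have "(L / H)\<^sup>2 \<le> 3 / (N + t)\<^sup>2"
    unfolding ratio by (rule divide_left_mono[OF high]) (use pos Nt in simp_all)
  also have "\<dots> = (sqrt 3 / (N + t))\<^sup>2"
    by (simp add: power_divide)
  finally show "L / H \<le> sqrt 3 / (N + t)"
    by (rule power2_le_imp_le) (use Nt in simp)
qed

lemma point_residual_eq: "point_residual x n = residual bridge_kernel (x ` {1..<Suc n}) parabola"
  by (simp only: atLeastLessThanSuc_atLeastAtMost)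

lemma norm_ratio_comparison:
  assumes D: "dyadic_sequence x"
  shows "sqrt 3 / (4 * sqrt 2) * (real n + 1) powi (- 1) =
             1 / sqrt 2 * (Linf_norm (equi_residual n) / H01_norm (equi_residual n)) \<and>
           1 / sqrt 2 * (Linf_norm (equi_residual n) / H01_norm (equi_residual n))
             \<le> Linf_norm (point_residual x n) / H01_norm (point_residual x n) \<and>
           Linf_norm (point_residual x n) / H01_norm (point_residual x n)
             \<le> 4 * (Linf_norm (equi_residual n) / H01_norm (equi_residual n)) \<and>
           4 * (Linf_norm (equi_residual n) / H01_norm (equi_residual n)) =
             sqrt 3 * (real n + 1) powi (- 1)"
proof -
  have equi: "Linf_norm (equi_residual n) / H01_norm (equi_residual n) = sqrt 3 / (4 * (real n + 1))"
    unfolding equi_residual_norms by (simp add: power2_eq_square)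
  \<comment> \<open>The residual after \<open>n\<close> points is indexed by the next point
    \<open>Suc n\<close>, which also covers \<open>n = 0\<close>.\<close>
  have "1 \<le> Suc n"
    by simp
  then obtain k i where n: "Suc n = 2 ^ k + i" and i: "i < 2 ^ k"
    by (rule dyadic_index)
  have m: "2 ^ k + real i = real n + 1"
  proof -
    have "real (Suc n) = real (2 ^ k + i)"
      by (simp only: n)
    then show ?thesis by simp
  qed
  have "real i \<le> real (2 ^ k)"
    using i by (intro of_nat_mono) simp
  then have ik: "real i \<le> 2 ^ k"
    by simp
  have r: "Linf_norm (point_residual x n) / H01_norm (point_residual x n)
      = 1 / (4 * (2 ^ k)\<^sup>2) / sqrt ((4 * 2 ^ k - 3 * real i) / (12 * (2 ^ k) ^ 3))"
    by (simp only: point_residual_eq n greedy_residual_norms[OF D i])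
  have low: "sqrt 3 / (4 * sqrt 2) / (real n + 1) \<le> Linf_norm (point_residual x n) / H01_norm (point_residual x n)"
    and high: "Linf_norm (point_residual x n) / H01_norm (point_residual x n) \<le> sqrt 3 / (real n + 1)"
    unfolding r m[symmetric] by (rule norm_ratio_bounds[OF _ _ ik]; simp)+
  have inv: "(real n + 1) powi (- 1) = 1 / (real n + 1)"
    by (simp add: power_int_minus inverse_eq_divide)
  have e: "sqrt 3 / (4 * sqrt 2) * (1 / m) = 1 / sqrt 2 * (sqrt 3 / (4 * m))"
    "1 / sqrt 2 * (sqrt 3 / (4 * m)) = sqrt 3 / (4 * sqrt 2) / m"
    "4 * (sqrt 3 / (4 * m)) = sqrt 3 / m" for m :: real
    by simp_all
  show ?thesis
    unfolding equi inv
  proof (intro conjI)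
    show "1 / sqrt 2 * (sqrt 3 / (4 * (real n + 1))) \<le> Linf_norm (point_residual x n) / H01_norm (point_residual x n)"
      unfolding e(2) by (rule low)
    show "Linf_norm (point_residual x n) / H01_norm (point_residual x n) \<le> 4 * (sqrt 3 / (4 * (real n + 1)))"
      unfolding e(3) by (rule high)
    show "4 * (sqrt 3 / (4 * (real n + 1))) = sqrt 3 * (1 / (real n + 1))"
      unfolding e(3) by simp
  qed (rule e(1))
qed

lemma level_norms:
  assumes D: "dyadic_sequence x" and l: "l \<ge> 1" "i < 2 ^ (l - 1)" "n = 2 ^ (l - 1) + i"
  shows "Linf_norm (point_residual x (n - 1)) = 2 powi (- 2 * int l)"
    and "H01_norm (point_residual x (n - 1)) =
      sqrt (2 powi (1 - 3 * int l) / 3 * (2 ^ (l + 1) - 3 * real i))"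
proof -
  obtain k where k: "l = Suc k"
    using l(1) by (cases l) auto
  have i: "i < 2 ^ k" and n: "Suc (n - 1) = 2 ^ k + i"
    using l k by simp_all
  \<comment> \<open>With \<open>l = k + 1\<close> the exponents become \<open>2 * k + 2\<close> and
    \<open>3 * k + 2\<close>; the two extra powers of 2 give the factor 4.\<close>
  have p2: "(2::real) powi (- 2 * int l) = 1 / (4 * (2 ^ k)\<^sup>2)"
  proof -
    have "- 2 * int l = - int (2 * k + 2)"
      by (simp add: k)
    then have "(2::real) powi (- 2 * int l) = inverse (2 ^ (2 * k + 2))"
      by (simp only: power_int_minus power_int_of_nat)
    moreover have "(2::real) ^ (2 * k) = (2 ^ k)\<^sup>2"
      by (simp add: power_mult[symmetric] mult.commute)
    ultimately show ?thesis
      by (simp add: power_add inverse_eq_divide)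
  qed
  have p3: "(2::real) powi (1 - 3 * int l) = 1 / (4 * (2 ^ k) ^ 3)"
  proof -
    have "1 - 3 * int l = - int (3 * k + 2)"
      by (simp add: k)
    then have "(2::real) powi (1 - 3 * int l) = inverse (2 ^ (3 * k + 2))"
      by (simp only: power_int_minus power_int_of_nat)
    moreover have "(2::real) ^ (3 * k) = (2 ^ k) ^ 3"
      by (simp add: power_mult[symmetric] mult.commute)
    ultimately show ?thesis
      by (simp add: power_add inverse_eq_divide)
  qed
  show "Linf_norm (point_residual x (n - 1)) = 2 powi (- 2 * int l)"
    unfolding point_residual_eq n greedy_residual_norms[OF D i] p2 ..
  have "2 powi (1 - 3 * int l) / 3 * (2 ^ (l + 1) - 3 * real i) = (4 * 2 ^ k - 3 * real i) / (12 * (2 ^ k) ^ 3)"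
    unfolding p3 by (simp add: k)
  then show "H01_norm (point_residual x (n - 1)) =
      sqrt (2 powi (1 - 3 * int l) / 3 * (2 ^ (l + 1) - 3 * real i))"
    by (simp only: point_residual_eq n greedy_residual_norms[OF D i])
qed

theorem lemma20:
  shows
    "is_rkhs \<Omega> bridge_kernel H01 H01_inner \<and> parabola \<in> H01 \<and>
     (\<forall>n::nat. n \<ge> 1 \<longrightarrow>
        (\<forall>X. is_arg_min (\<lambda>X. Linf_norm (residual bridge_kernel X parabola))
               (\<lambda>X. X \<subseteq> \<Omega> \<and> finite X \<and> card X = n) X \<longleftrightarrow> X = equi_points n) \<and>
        Linf_norm (equi_residual (n - 1)) = 1 / 4 * real n powi (- 2) \<and>
        H01_norm (equi_residual (n - 1)) = 1 / sqrt 3 * real n powi (- 1)) \<and>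
     (\<forall>x. f_greedy \<Omega> bridge_kernel parabola x \<longleftrightarrow>
        (\<forall>l::nat. l \<ge> 1 \<longrightarrow>
           bij_betw (\<lambda>i. x (2 ^ (l - 1) + i)) {..<2 ^ (l - 1)}
             {(2 * real i + 1) / 2 ^ l | i. i < 2 ^ (l - 1)})) \<and>
     (\<forall>x. f_greedy \<Omega> bridge_kernel parabola x \<longrightarrow>
        (\<forall>l i n :: nat. l \<ge> 1 \<and> i < 2 ^ (l - 1) \<and> n = 2 ^ (l - 1) + i \<longrightarrow>
           Linf_norm (point_residual x (n - 1)) = 2 powi (- 2 * int l) \<and>
           H01_norm (point_residual x (n - 1)) =
             sqrt (2 powi (1 - 3 * int l) / 3 * (2 ^ (l + 1) - 3 * real i))) \<and>
        (\<forall>n::nat.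
           sqrt 3 / (4 * sqrt 2) * (real n + 1) powi (- 1) =
             1 / sqrt 2 * (Linf_norm (equi_residual n) / H01_norm (equi_residual n)) \<and>
           1 / sqrt 2 * (Linf_norm (equi_residual n) / H01_norm (equi_residual n))
             \<le> Linf_norm (point_residual x n) / H01_norm (point_residual x n) \<and>
           Linf_norm (point_residual x n) / H01_norm (point_residual x n)
             \<le> 4 * (Linf_norm (equi_residual n) / H01_norm (equi_residual n)) \<and>
           4 * (Linf_norm (equi_residual n) / H01_norm (equi_residual n)) =
             sqrt 3 * (real n + 1) powi (- 1)))"
proof (intro conjI allI impI)
  show "is_rkhs \<Omega> bridge_kernel H01 H01_inner"
    by (rule bridge_kernel_rkhs)
  show "parabola \<in> H01"
    by (rule parabola_H01)
  fix n :: nat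
  show "is_arg_min (\<lambda>X. Linf_norm (residual bridge_kernel X parabola))
      (\<lambda>X. X \<subseteq> \<Omega> \<and> finite X \<and> card X = n) X \<longleftrightarrow> X = equi_points n" for X
    by (rule equi_points_unique_minimizer)
  assume "1 \<le> n"
  then have n: "real (n - 1) + 1 = real n"
    by simp
  show "Linf_norm (equi_residual (n - 1)) = 1 / 4 * real n powi (- 2)"
  proof -
    have "real n powi (- 2) = 1 / (real n)\<^sup>2"
      by (simp add: power_int_minus inverse_eq_divide)
    then show ?thesis
      unfolding equi_residual_norms n by simp
  qed
  show "H01_norm (equi_residual (n - 1)) = 1 / sqrt 3 * real n powi (- 1)"
  proof -
    have "real n powi (- 1) = 1 / real n"
      by (simp add: power_int_minus inverse_eq_divide)
    then show ?thesis
      unfolding equi_residual_norms n by simp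
  qed
next
  fix x
  show "f_greedy \<Omega> bridge_kernel parabola x \<longleftrightarrow>
      (\<forall>l::nat. l \<ge> 1 \<longrightarrow>
         bij_betw (\<lambda>i. x (2 ^ (l - 1) + i)) {..<2 ^ (l - 1)}
           {(2 * real i + 1) / 2 ^ l | i. i < 2 ^ (l - 1)})"
    unfolding f_greedy_iff_dyadic by (rule dyadic_sequence_levels)
next
  fix x and l i n :: nat
  assume "f_greedy \<Omega> bridge_kernel parabola x" and l: "l \<ge> 1 \<and> i < 2 ^ (l - 1) \<and> n = 2 ^ (l - 1) + i"
  then have D: "dyadic_sequence x"
    by (simp only: f_greedy_iff_dyadic)
  show "Linf_norm (point_residual x (n - 1)) = 2 powi (- 2 * int l)"
    by (rule level_norms(1)[OF D]) (use l in blast)+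
  show "H01_norm (point_residual x (n - 1)) = sqrt (2 powi (1 - 3 * int l) / 3 * (2 ^ (l + 1) - 3 * real i))"
    by (rule level_norms(2)[OF D]) (use l in blast)+
next
  fix x and n :: nat
  assume "f_greedy \<Omega> bridge_kernel parabola x"
  then have D: "dyadic_sequence x"
    by (simp only: f_greedy_iff_dyadic)
  note R = norm_ratio_comparison[OF D, of n]
  show "sqrt 3 / (4 * sqrt 2) * (real n + 1) powi (- 1) =
      1 / sqrt 2 * (Linf_norm (equi_residual n) / H01_norm (equi_residual n))"
    by (rule R[THEN conjunct1])
  show "1 / sqrt 2 * (Linf_norm (equi_residual n) / H01_norm (equi_residual n))
      \<le> Linf_norm (point_residual x n) / H01_norm (point_residual x n)"
    by (rule R[THEN conjunct2, THEN conjunct1])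
  show "Linf_norm (point_residual x n) / H01_norm (point_residual x n)
      \<le> 4 * (Linf_norm (equi_residual n) / H01_norm (equi_residual n))"
    by (rule R[THEN conjunct2, THEN conjunct2, THEN conjunct1])
  show "4 * (Linf_norm (equi_residual n) / H01_norm (equi_residual n)) = sqrt 3 * (real n + 1) powi (- 1)"
    by (rule R[THEN conjunct2, THEN conjunct2, THEN conjunct2])
qed

end
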